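(* Let $\kappa\in(-\infty,1]$. For every $\ell>0$, the magnitude of the circle $C_{\ell,\kappa}$ of length $\ell$ with the $\kappa$-metric is \[|C_{\ell,\kappa}| = \left(\int_0^1 e^{-\ell D_\kappa(s)}\,\mathrm ds\right)^{-1},\] and asymptotically it behaves as follows: \[|C_{\ell,\kappa}| = \ell/2+O(\ell^{-1})\quad\text{as }\ell\to\infty.\]
   Context: For $s\in[0,1]$ define $D_\kappa(s)=\frac{1}{\sqrt\kappa\,\pi}\sin^{-1}\bigl(\sqrt\kappa\sin(\pi s)\bigr)$ if $0<\kappa\le 1$ (with $\sin^{-1}\colon[0,1]\to[0,\pi/2]$), $D_0(s)=\frac1\pi\sin(\pi s)$, and $D_\kappa(s)=\frac{1}{\sqrt{-\kappa}\,\pi}\sinh^{-1}\bigl(\sqrt{-\kappa}\sin(\pi s)\bigr)$ if $\kappa<0$. The metric space $C_{\ell,\kappa}$ is the circle of length $\ell$ in which the distance between two points separated by an arc of length $x\in[0,\ell]$ is $D_{\ell,\kappa}(x)=\ell D_\kappa(x/\ell)$ (the $\kappa$-metric). This is the subspace metric on a circle of circumference $\ell$ embedded as a locus of points equidistant from a fixed point in the sphere ($\kappa>0$), Euclidean plane ($\kappa=0$) or hyperbolic plane ($\kappa<0$) of constant curvature $4\pi^2\kappa/\ell^2$; $\kappa=1$ gives the arc-length metric and $\kappa=0$ the Euclidean subspace metric. A weighting on a finite metric space $(W,d)$ is a choice of real number $w_x$ for each $x\in W$ such that $\sum_{x'\in W} e^{-d(x,x')}w_{x'}=1$ for every $x\in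 W$. If a weighting exists, the magnitude of $W$ is $|W| := \sum_{x\in W} w_x$; this is independent of the choice of weighting. A metric space $X$ is positive definite if for every finite subspace $W\subseteq X$ the matrix $(e^{-d(x,x')})_{x,x'\in W}$ is positive definite; finite positive definite spaces have a well-defined magnitude. The magnitude of a compact positive definite metric space $X$ is defined as $|X| := \sup\{|W| : W\subseteq X\text{ finite}\}$; equivalently (a result of Meckes), $|X|=\lim_{k}|X_k|$ for any sequence $(X_k)$ of finite subsets of $X$ converging to $X$ in the Hausdorff metric. The spaces $C_{\ell,\kappa}$ are compact and positive definite (a known fact). *)

theory Defs
  imports "HOL-Analysis.Analysis" "HOL-Library.Landau_Symbols"
begin

definition D_kappa :: "real \<Rightarrow> real \<Rightarrow> real" where
  "D_kappa \<kappa> s =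
     (if \<kappa> > 0 then arcsin (sqrt \<kappa> * sin (pi * s)) / (sqrt \<kappa> * pi)
      else if \<kappa> = 0 then sin (pi * s) / pi
      else arsinh (sqrt (- \<kappa>) * sin (pi * s)) / (sqrt (- \<kappa>) * pi))"

text \<open>
  Points of the circle of length \<open>L\<close> are given by their arc-length parameter in \<open>{0..<L}\<close>, so
  that \<open>\<bar>x - y\<bar>\<close> is the length of one of the two arcs between \<open>x\<close> and \<open>y\<close>; as
  \<open>D_kappa \<kappa> s = D_kappa \<kappa> (1 - s)\<close>, the choice of arc is irrelevant. The value \<open>0\<close> outside
  the carrier is only there because \<^locale>\<open>Metric_space\<close> asks for nonnegativity on the whole type.
\<close>

definition kappa_dist :: "real \<Rightarrow> real \<Rightarrow> real \<Rightarrow> real \<Rightarrow> real" where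
  "kappa_dist L \<kappa> x y =
     (if x \<in> {0..<L} \<and> y \<in> {0..<L} then L * D_kappa \<kappa> (\<bar>x - y\<bar> / L) else 0)"

definition kappa_circle :: "real \<Rightarrow> real \<Rightarrow> real metric" where
  "kappa_circle L \<kappa> = metric ({0..<L}, kappa_dist L \<kappa>)"

definition weighting :: "'a metric \<Rightarrow> ('a \<Rightarrow> real) \<Rightarrow> bool" where
  "weighting m w \<longleftrightarrow>
     (\<forall>x\<in>mspace m. (\<Sum>x'\<in>mspace m. exp (- mdist m x x') * w x') = 1)"

text \<open>
  For a finite space with a weighting the number described here is unique
  (\<open>finite_magnitude_eq\<close> below).
\<close>

definition finite_magnitude :: "'a metric \<Rightarrow> real" where
  "finite_magnitude m = (THE r. \<exists>w. weighting m w \<and> r = (\<Sum>x\<in>mspace m. w x))"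

text \<open>
  The definition is meaningful for compact positive definite spaces. The supremum is taken in the
  extended reals, so that it never silently denotes an unspecified number.
\<close>

definition magnitude :: "'a metric \<Rightarrow> ereal" where
  "magnitude m = (SUP W\<in>{W. finite W \<and> W \<subseteq> mspace m}. ereal (finite_magnitude (submetric m W)))"

lemma finite_magnitude_eq:
  assumes w: "weighting m w"
  shows "finite_magnitude m = (\<Sum>x\<in>mspace m. w x)"
proof -
  have "(\<Sum>x\<in>mspace m. v x) = (\<Sum>x\<in>mspace m. w x)" if v: "weighting m v" for v
  proof -
    have "(\<Sum>x\<in>mspace m. v x) =
        (\<Sum>x\<in>mspace m. (\<Sum>y\<in>mspace m. exp (- mdist m x y) * w y) * v x)"
      using w by (intro sum.cong) (auto simp: weighting_def)
    also have "\<dots> = (\<Sum>x\<in>mspace m. \<Sum>y\<in>mspace m. exp (- mdist m y x) * v x * w y)"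
      unfolding sum_distrib_right
    proof (intro sum.cong refl)
      fix x y
      show "exp (- mdist m x y) * w y * v x = exp (- mdist m y x) * v x * w y"
        by (subst mdist_commute) simp
    qed
    also have "\<dots> = (\<Sum>y\<in>mspace m. (\<Sum>x\<in>mspace m. exp (- mdist m y x) * v x) * w y)"
      by (subst sum.swap) (simp add: sum_distrib_right)
    also have "\<dots> = (\<Sum>y\<in>mspace m. w y)"
      using v by (intro sum.cong) (auto simp: weighting_def)
    finally show ?thesis .
  qed
  with w show ?thesis
    unfolding finite_magnitude_def by (intro the_equality) blast+
qed

text \<open>
  The remaining lemmas show that \<^const>\<open>kappa_dist\<close> is a metric on \<open>{0..<L}\<close>, so that
  \<^const>\<open>kappa_circle\<close> has the intended points and distances.
\<close>

definition D_fun :: "real \<Rightarrow> real \<Rightarrow> real" where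
  "D_fun \<kappa> u =
     (if \<kappa> > 0 then arcsin (sqrt \<kappa> * u) / (sqrt \<kappa> * pi)
      else if \<kappa> = 0 then u / pi
      else arsinh (sqrt (- \<kappa>) * u) / (sqrt (- \<kappa>) * pi))"

lemma D_kappa_eq: "D_kappa \<kappa> s = D_fun \<kappa> (sin (pi * s))"
  by (simp add: D_kappa_def D_fun_def)

lemma sqrt_kappa_mult:
  assumes "0 < \<kappa>" "\<kappa> \<le> 1" "0 \<le> u" "u \<le> 1"
  shows "0 \<le> sqrt \<kappa> * u" "sqrt \<kappa> * u \<le> 1" 
  using assms by (auto intro: mult_le_one)

lemma D_fun_nonneg:
  assumes "\<kappa> \<le> 1" "0 \<le> u" "u \<le> 1"
  shows "0 \<le> D_fun \<kappa> u"
proof (cases "\<kappa> > 0")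
  case True
  then have "0 \<le> arcsin (sqrt \<kappa> * u)"
    using arcsin_le_arcsin[of 0 "sqrt \<kappa> * u"] sqrt_kappa_mult[OF True assms] by simp
  with True show ?thesis by (simp add: D_fun_def)
next
  case False
  have "\<not> arsinh (sqrt (- \<kappa>) * u) < 0"
    using False assms by (simp add: mult_less_0_iff)
  then have "0 \<le> arsinh (sqrt (- \<kappa>) * u)" by (rule leI)
  moreover have "0 \<le> sqrt (- \<kappa>) * pi" using False by simp
  ultimately have "0 \<le> arsinh (sqrt (- \<kappa>) * u) / (sqrt (- \<kappa>) * pi)"
    by (rule divide_nonneg_nonneg)
  moreover have "0 \<le> u / pi" using assms by simp
  ultimately show ?thesis
    using False unfolding D_fun_def by (simp only: if_False if_True split: if_split) simp
qed

lemma D_fun_eq_0_iff: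
  assumes "\<kappa> \<le> 1" "0 \<le> u" "u \<le> 1"
  shows "D_fun \<kappa> u = 0 \<longleftrightarrow> u = 0"
proof (cases "\<kappa> > 0")
  case True
  have "arcsin (sqrt \<kappa> * u) = 0 \<longleftrightarrow> sqrt \<kappa> * u = 0"
    using arcsin_eq_iff[of "sqrt \<kappa> * u" 0] sqrt_kappa_mult[OF True assms] by simp
  with True show ?thesis by (simp add: D_fun_def)
next
  case False
  then show ?thesis
    unfolding D_fun_def by (simp only: if_False divide_eq_0_iff arsinh_real_eq_0_iff mult_eq_0_iff
      real_sqrt_eq_zero_cancel_iff neg_equal_0_iff_equal pi_neq_zero split: if_split) simp
qed

lemma D_fun_triangle:
  assumes \<kappa>: "\<kappa> \<le> 1" and u: "0 \<le> u" "u \<le> 1" and v: "0 \<le> v" "v \<le> 1" and w: "0 \<le> w" "w \<le> 1"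
    and le: "w \<le> u * sqrt (1 - v\<^sup>2) + v * sqrt (1 - u\<^sup>2)"
  shows "D_fun \<kappa> w \<le> D_fun \<kappa> u + D_fun \<kappa> v"
proof -
  consider "\<kappa> > 0" | "\<kappa> = 0" | "\<kappa> < 0" by linarith
  then show ?thesis
  proof cases
    case 1
    define k where "k = sqrt \<kappa>"
    have k: "k > 0" "k \<le> 1" using 1 \<kappa> by (auto simp: k_def)
    note ku = sqrt_kappa_mult[OF 1 \<kappa> u, folded k_def]
    note kv = sqrt_kappa_mult[OF 1 \<kappa> v, folded k_def]
    note kw = sqrt_kappa_mult[OF 1 \<kappa> w, folded k_def]
    define A where "A = arcsin (k * u)"
    define B where "B = arcsin (k * v)"
    have A: "sin A = k * u" "cos A = sqrt (1 - (k * u)\<^sup>2)" "0 \<le> A" "A \<le> pi / 2"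
      using ku arcsin_le_arcsin[of 0 "k * u"] arcsin_ubound[of "k * u"]
      by (auto simp: A_def cos_arcsin)
    have B: "sin B = k * v" "cos B = sqrt (1 - (k * v)\<^sup>2)" "0 \<le> B" "B \<le> pi / 2"
      using kv arcsin_le_arcsin[of 0 "k * v"] arcsin_ubound[of "k * v"]
      by (auto simp: B_def cos_arcsin)
    have "arcsin (k * w) \<le> A + B"
    proof (cases "A + B \<le> pi / 2")
      case True
      have sq: "(k * x)\<^sup>2 \<le> x\<^sup>2" if "0 \<le> x" for x
        using k that by (intro power_mono) (auto intro: mult_left_le_one_le)
      have "k * w \<le> k * (u * sqrt (1 - v\<^sup>2) + v * sqrt (1 - u\<^sup>2))"
        using le k by simp
      also have "\<dots> = (k * u) * sqrt (1 - v\<^sup>2) + sqrt (1 - u\<^sup>2) * (k * v)"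
        by (simp add: algebra_simps)
      also have "\<dots> \<le> sin A * cos B + cos A * sin B"
        unfolding A B using ku kv sq[of u] sq[of v] u v
        by (intro add_mono mult_left_mono mult_right_mono) auto
      also have "\<dots> = sin (A + B)" by (simp add: sin_add)
      finally have "arcsin (k * w) \<le> arcsin (sin (A + B))"
        using kw by (intro arcsin_le_arcsin) auto
      also have "\<dots> = A + B"
        using True A B by (intro arcsin_sin) auto
      finally show ?thesis .
    next
      case False
      then show ?thesis using arcsin_ubound[of "k * w"] kw by auto
    qed
    then have "arcsin (k * w) / (k * pi) \<le> (A + B) / (k * pi)"
      using k by (intro divide_right_mono) auto
    then show ?thesis
      using 1 by (simp add: D_fun_def A_def B_def k_def add_divide_distrib)
  next
    case 2
    have "w \<le> u * 1 + v * 1"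
      using le u v by (intro order.trans[OF le] add_mono mult_left_mono) auto
    with 2 show ?thesis by (simp add: D_fun_def field_simps)
  next
    case 3
    define k where "k = sqrt (- \<kappa>)"
    have k: "k > 0" using 3 by (simp add: k_def)
    define A where "A = arsinh (k * u)"
    define B where "B = arsinh (k * v)"
    have "k * w \<le> k * (u * sqrt (1 - v\<^sup>2) + v * sqrt (1 - u\<^sup>2))"
      using le k by simp
    also have "\<dots> = (k * u) * sqrt (1 - v\<^sup>2) + sqrt (1 - u\<^sup>2) * (k * v)"
      by (simp add: algebra_simps)
    also have "\<dots> \<le> (k * u) * sqrt ((k * v)\<^sup>2 + 1) + sqrt ((k * u)\<^sup>2 + 1) * (k * v)"
      using k u v by (intro add_mono mult_left_mono mult_right_mono real_sqrt_le_mono)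
        (auto intro: order.trans[of _ 1])
    also have "\<dots> = sinh (A + B)"
      by (simp add: A_def B_def sinh_add cosh_arsinh_real)
    finally have "sinh (arsinh (k * w)) \<le> sinh (A + B)" by simp
    then have "arsinh (k * w) \<le> A + B" by (simp only: sinh_real_le_iff)
    then have "arsinh (k * w) / (k * pi) \<le> (A + B) / (k * pi)"
      using k by (intro divide_right_mono) auto
    then show ?thesis
      using 3 by (simp add: D_fun_def A_def B_def k_def add_divide_distrib)
  qed
qed

lemma kappa_dist_eq:
  assumes "0 < L" "x \<in> {0..<L}" "y \<in> {0..<L}"
  shows "kappa_dist L \<kappa> x y = L * D_fun \<kappa> \<bar>sin (pi * ((x - y) / L))\<bar>"
proof -
  have "\<bar>x - y\<bar> / L \<le> 1" "\<bar>x - y\<bar> / L \<ge> 0" using assms by (auto simp: field_simps)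
  then have "0 \<le> sin (pi * (\<bar>x - y\<bar> / L))"
    by (intro sin_ge_zero mult_nonneg_nonneg mult_left_le) auto
  moreover have "\<bar>sin (pi * (\<bar>x - y\<bar> / L))\<bar> = \<bar>sin (pi * ((x - y) / L))\<bar>"
  proof (cases "x \<ge> y")
    case False
    then have "pi * (\<bar>x - y\<bar> / L) = - (pi * ((x - y) / L))"
      by (simp add: minus_divide_left right_diff_distrib)
    then show ?thesis by (simp only: sin_minus abs_minus_cancel)
  qed simp
  ultimately show ?thesis
    using assms by (simp add: kappa_dist_def D_kappa_eq)
qed

lemma Metric_space_kappa_circle:
  assumes "0 < L" "\<kappa> \<le> 1"
  shows "Metric_space {0..<L} (kappa_dist L \<kappa>)"
proof
  fix x y
  show "0 \<le> kappa_dist L \<kappa> x y"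
  proof (cases "x \<in> {0..<L} \<and> y \<in> {0..<L}")
    case True
    then show ?thesis using assms by (simp add: kappa_dist_eq D_fun_nonneg del: atLeastLessThan_iff)
  qed (auto simp: kappa_dist_def)
  show "kappa_dist L \<kappa> x y = kappa_dist L \<kappa> y x"
    by (simp add: kappa_dist_def abs_minus_commute)
next
  fix x y assume xy: "x \<in> {0..<L}" "y \<in> {0..<L}"
  have "kappa_dist L \<kappa> x y = 0 \<longleftrightarrow> sin (pi * ((x - y) / L)) = 0"
    using assms xy by (simp add: kappa_dist_eq D_fun_eq_0_iff del: atLeastLessThan_iff)
  also have "\<dots> \<longleftrightarrow> x = y"
  proof
    assume "sin (pi * ((x - y) / L)) = 0"
    then obtain i :: int where "pi * ((x - y) / L) = of_int i * pi"
      by (auto simp: sin_zero_iff_int2)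
    then have "pi * ((x - y) / L) = pi * of_int i"
      by (rule trans) (rule mult.commute)
    then have i: "(x - y) / L = of_int i"
      unfolding mult_cancel_left using pi_neq_zero by blast
    have "\<bar>(x - y) / L\<bar> < 1" using xy assms by (auto simp: field_simps)
    with i have "i = 0" by linarith
    with i assms show "x = y" by simp
  qed simp
  finally show "kappa_dist L \<kappa> x y = 0 \<longleftrightarrow> x = y" .
next
  fix x y z assume xyz: "x \<in> {0..<L}" "y \<in> {0..<L}" "z \<in> {0..<L}"
  define a where "a = pi * ((x - y) / L)"
  define b where "b = pi * ((y - z) / L)"
  have ab: "pi * ((x - z) / L) = a + b" 
    by (simp add: a_def b_def diff_divide_distrib algebra_simps)
  have cos: "\<bar>cos t\<bar> = sqrt (1 - \<bar>sin t\<bar>\<^sup>2)" for t :: real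
    by (simp add: cos_squared_eq[symmetric])
  have "\<bar>sin (a + b)\<bar> \<le> \<bar>sin a * cos b\<bar> + \<bar>cos a * sin b\<bar>"
    by (simp add: sin_add abs_triangle_ineq)
  also have "\<dots> = \<bar>sin a\<bar> * sqrt (1 - \<bar>sin b\<bar>\<^sup>2) + \<bar>sin b\<bar> * sqrt (1 - \<bar>sin a\<bar>\<^sup>2)"
    unfolding cos[symmetric] by (simp add: abs_mult)
  finally have "D_fun \<kappa> \<bar>sin (a + b)\<bar> \<le> D_fun \<kappa> \<bar>sin a\<bar> + D_fun \<kappa> \<bar>sin b\<bar>"
    using assms by (intro D_fun_triangle) auto
  then show "kappa_dist L \<kappa> x z \<le> kappa_dist L \<kappa> x y + kappa_dist L \<kappa> y z"
    unfolding kappa_dist_eq[OF assms(1) xyz(1,2)] kappa_dist_eq[OF assms(1) xyz(2,3)]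
      kappa_dist_eq[OF assms(1) xyz(1,3)] ab
    using assms(1) unfolding a_def b_def distrib_left[symmetric] by (intro mult_left_mono) auto
qed

lemma mspace_kappa_circle:
  "0 < L \<Longrightarrow> \<kappa> \<le> 1 \<Longrightarrow> mspace (kappa_circle L \<kappa>) = {0..<L}"
  by (simp add: kappa_circle_def Metric_space.mspace_metric[OF Metric_space_kappa_circle])

lemma mdist_kappa_circle:
  "0 < L \<Longrightarrow> \<kappa> \<le> 1 \<Longrightarrow> mdist (kappa_circle L \<kappa>) = kappa_dist L \<kappa>"
  by (simp add: kappa_circle_def Metric_space.mdist_metric[OF Metric_space_kappa_circle])

end

theory Submission
  imports Defs
begin

text \<open>
  On \<open>[0, 1/2]\<close> the function \<open>D\<^sub>\<kappa>\<close> is increasing and concave, so \<open>f(s) = exp (- L D\<^sub>\<kappa>(s))\<close> is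
  decreasing and convex there, and \<open>f(1 - s) = f(s)\<close>. Hence on any finite set of distances \<open>f\<close>
  agrees with a constant plus a nonnegative combination of tent functions, each of which is the
  overlap kernel of arcs of some fixed length. By the Cauchy--Schwarz inequality for these kernels,
  \<open>\<Sum>\<^sub>x\<^sub>y v\<^sub>x v\<^sub>y exp (- d(x, y)) \<ge> I (\<Sum>\<^sub>x v\<^sub>x)\<^sup>2\<close> with \<open>I = \<integral> f\<close>, for all finite subsets of the circle.
  This one inequality gives both the existence of weightings and the upper bound \<open>1 / I\<close> for the
  magnitude of finite subsets. Equally spaced points have a constant weighting, and their
  magnitudes are inverses of Riemann sums of \<open>f\<close>, so the supremum is \<open>1 / I\<close>.
  The asymptotics follow from \<open>s - O(s\<^sup>3) \<le> D\<^sub>\<kappa>(s) \<le> s\<close> and \<open>D\<^sub>\<kappa>(s) \<ge> c s\<close> on \<open>[0, 1/2]\<close>, which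
  give \<open>I = 2 / L + O(L\<^sup>-\<^sup>3)\<close>.
\<close>

section \<open>Convex kernels on the circle\<close>

text \<open>Clearing the denominator \<open>z - x\<close> covers the degenerate case
  \<open>x = z\<close> and lets the same inequality serve for interpolation between two points and
  for extrapolation beyond them.\<close>

lemma convex_on_cross_mult:
  fixes f :: "real \<Rightarrow> real"
  assumes "convex_on S f" "x \<in> S" "z \<in> S" "x \<le> y" "y \<le> z"
  shows "(z - x) * f y \<le> (z - y) * f x + (y - x) * f z"
proof (cases "x = z")
  case False
  with assms have xz: "x < z" by simp
  define t where "t = (y - x) / (z - x)"
  have t: "0 \<le> t" "t \<le> 1" and eq: "t * (z - x) = y - x" "(1 - t) * (z - x) = z - y"
    using assms xz by (auto simp: t_def field_simps)
  have y: "y = (1 - t) * x + t * z" using eq(1) by (simp add: algebra_simps)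
  have "f y \<le> (1 - t) * f x + t * f z"
    using convex_onD[OF assms(1) t assms(2,3)] unfolding y by simp
  then have "(z - x) * f y \<le> (z - x) * ((1 - t) * f x + t * f z)"
    using xz by (intro mult_left_mono) auto
  also have "\<dots> = ((1 - t) * (z - x)) * f x + (t * (z - x)) * f z"
    by (simp only: algebra_simps)
  finally show ?thesis unfolding eq .
qed (use assms in auto)

text \<open>
  The right-hand side is the piecewise linear interpolation of \<open>f\<close> on \<open>S\<close>. The induction adds
  points from right to left; it also needs that the extension of the leftmost piece stays below \<open>f\<close>,
  which makes the slope change at the next point nonnegative.
\<close>

lemma convex_tent_interpolation:
  fixes f :: "real \<Rightarrow> real"
  assumes "finite S" "S \<noteq> {}" "S \<subseteq> {l..h}"
    and conv: "convex_on {l..h} f"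
    and anti: "\<And>x y. l \<le> x \<Longrightarrow> x \<le> y \<Longrightarrow> y \<le> h \<Longrightarrow> f y \<le> f x"
  shows "\<exists>c a. (\<forall>t\<in>S. 0 \<le> a t) \<and>
    (\<forall>s\<in>S. f s = c + (\<Sum>t\<in>S. a t * max 0 (t - s))) \<and>
    (\<forall>s\<in>{Min S..h}. f s \<le> c + (\<Sum>t\<in>S. a t * max 0 (t - s)))"
proof -
  define P :: "real \<Rightarrow> (real \<Rightarrow> real) \<Rightarrow> real set \<Rightarrow> real \<Rightarrow> real"
    where "P = (\<lambda>c a S s. c + (\<Sum>t\<in>S. a t * max 0 (t - s)))"
  have "\<exists>c a. (\<forall>t\<in>S. 0 \<le> a t) \<and> (\<forall>s\<in>S. f s = P c a S s) \<and>
      (\<forall>s. Min S \<le> s \<longrightarrow> s \<le> h \<longrightarrow> f s \<le> P c a S s) \<and>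
      (\<forall>s. l \<le> s \<longrightarrow> s \<le> Min S \<longrightarrow> P c a S s \<le> f s)"
    using assms(1-3)
  proof (induction S rule: finite_linorder_min_induct)
    case (insert b A)
    show ?case
    proof (cases "A = {}")
      case True
      \<comment> \<open>At a single point the constant \<open>f b\<close> suffices: by monotonicity
        it lies above \<open>f\<close> to the right of \<open>b\<close> and below \<open>f\<close>
        to the left.\<close>
      have "(\<forall>t\<in>insert b A. 0 \<le> (0::real)) \<and> (\<forall>s\<in>insert b A. f s = P (f b) (\<lambda>_. 0) (insert b A) s) \<and>
        (\<forall>s. Min (insert b A) \<le> s \<longrightarrow> s \<le> h \<longrightarrow> f s \<le> P (f b) (\<lambda>_. 0) (insert b A) s) \<and>
        (\<forall>s. l \<le> s \<longrightarrow> s \<le> Min (insert b A) \<longrightarrow> P (f b) (\<lambda>_. 0) (insert b A) s \<le> f s)"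
        using True insert.prems by (auto simp: P_def intro!: anti)
      then show ?thesis by (intro exI)
    next
      case False
      have "A \<subseteq> {l..h}" using insert.prems by simp
      from insert.IH[OF False this] obtain c a where a: "\<And>t. t \<in> A \<Longrightarrow> 0 \<le> a t"
        and eq: "\<And>s. s \<in> A \<Longrightarrow> f s = P c a A s"
        and ge: "\<And>s. Min A \<le> s \<Longrightarrow> s \<le> h \<Longrightarrow> f s \<le> P c a A s"
        and le: "\<And>s. l \<le> s \<Longrightarrow> s \<le> Min A \<Longrightarrow> P c a A s \<le> f s"
        by blast
      define m where "m = Min A"
      have mA: "m \<in> A" and m_le: "\<And>t. t \<in> A \<Longrightarrow> m \<le> t"
        using False insert.hyps by (auto simp: m_def)
      have bm: "b < m" and b: "b \<notin> A" using mA insert.hyps by auto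
      have lb: "l \<le> b" and mh: "m \<le> h" using insert.prems mA by auto
      \<comment> \<open>A tent with kink \<open>m\<close> vanishes at and right of \<open>m\<close>,
        so the earlier values persist; weight \<open>d\<close> lifts the value at \<open>b\<close>
        to \<open>f b\<close>. It is nonnegative because the old leftmost piece, continued to
        \<open>b\<close>, stays below \<open>f\<close>. The kink at \<open>b\<close> gets weight 0
        until a further point is inserted.\<close>
      define d where "d = (f b - P c a A b) / (m - b)"
      have d: "0 \<le> d" using le[of b] lb bm by (auto simp: d_def m_def)
      define a' where "a' = a(m := a m + d, b := 0)"
      have P': "P c a' (insert b A) s = P c a A s + d * max 0 (m - s)" for s
      proof -
        have "(\<Sum>t\<in>A. a' t * max 0 (t - s)) =
            (\<Sum>t\<in>A. a t * max 0 (t - s) + (if t = m then d * max 0 (m - s) else 0))"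
          using b by (intro sum.cong) (auto simp: a'_def algebra_simps)
        also have "\<dots> = (\<Sum>t\<in>A. a t * max 0 (t - s)) + d * max 0 (m - s)"
          using insert.hyps(1) mA by (simp add: sum.distrib)
        finally show ?thesis using insert.hyps(1) b by (simp add: P_def a'_def)
      qed
      \<comment> \<open>All terms of nonzero weight have kinks at or right of \<open>m\<close>, so
        left of \<open>m\<close> the new interpolation is the line through the graph points at
        \<open>b\<close> and \<open>m\<close>. By convexity \<open>f\<close> is below this line
        between \<open>b\<close> and \<open>m\<close> and above it left of \<open>b\<close>.\<close>
      define \<alpha> \<beta> where "\<alpha> = c + (\<Sum>t\<in>A. a t * t) + d * m" and "\<beta> = (\<Sum>t\<in>A. a t) + d"
      have affine: "P c a' (insert b A) s = \<alpha> - \<beta> * s" if "s \<le> m" for s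
      proof -
        have "(\<Sum>t\<in>A. a t * max 0 (t - s)) = (\<Sum>t\<in>A. a t * t - a t * s)"
          using m_le that by (intro sum.cong) (force simp: algebra_simps max_def)+
        then show ?thesis
          using that unfolding P'
          by (simp add: P_def \<alpha>_def \<beta>_def sum_subtractf sum_distrib_left algebra_simps)
      qed
      have Pm: "P c a' (insert b A) m = f m" using eq[OF mA] by (simp add: P')
      have Pb: "P c a' (insert b A) b = f b" using bm by (simp add: P' d_def)
      have "\<forall>t\<in>insert b A. 0 \<le> a' t" using a d mA by (auto simp: a'_def)
      moreover have "\<forall>s\<in>insert b A. f s = P c a' (insert b A) s"
        using Pb eq m_le by (auto simp: P')
      moreover have "f s \<le> P c a' (insert b A) s" if "Min (insert b A) \<le> s" "s \<le> h" for s
      proof (cases "m \<le> s")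
        case True
        then show ?thesis using ge[of s] that by (simp add: P' m_def[symmetric])
      next
        case False
        have bs: "b \<le> s" using that False insert.hyps bm m_le \<open>A \<noteq> {}\<close> by (simp add: m_def split: if_splits)
        have "(m - b) * f s \<le> (m - s) * f b + (s - b) * f m"
          using False bs lb mh bm by (intro convex_on_cross_mult[OF conv]) auto
        also have "\<dots> = (m - b) * P c a' (insert b A) s"
          using False bm unfolding Pm[symmetric] Pb[symmetric] by (simp add: affine algebra_simps)
        finally show ?thesis using bm by simp
      qed
      moreover have "P c a' (insert b A) s \<le> f s" if "l \<le> s" "s \<le> Min (insert b A)" for s
      proof -
        have sb: "s \<le> b" using that insert.hyps by simp
        have "(m - s) * f b \<le> (m - b) * f s + (b - s) * f m"
          using sb that lb mh bm by (intro convex_on_cross_mult[OF conv]) auto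
        moreover have "(m - s) * f b = (m - b) * P c a' (insert b A) s + (b - s) * f m"
          using sb bm unfolding Pm[symmetric] Pb[symmetric] by (simp add: affine algebra_simps)
        ultimately show ?thesis using bm by simp
      qed
      ultimately show ?thesis by blast
    qed
  qed simp
  then obtain c a where "\<forall>t\<in>S. 0 \<le> a t" "\<forall>s\<in>S. f s = P c a S s"
    "\<forall>s. Min S \<le> s \<longrightarrow> s \<le> h \<longrightarrow> f s \<le> P c a S s"
    by blast
  then show ?thesis unfolding P_def by (intro exI[of _ c] exI[of _ a]) simp
qed

section \<open>Tent kernels from overlapping arcs, and the inequality for convex kernels\<close>

text \<open>The length of the overlap of two arcs of length \<open>a\<close> on a circle of length 1, one shifted by \<open>d\<close>.\<close>

definition tent :: "real \<Rightarrow> real \<Rightarrow> real" where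
  "tent a d = max 0 (a - d) + max 0 (a - (1 - d))"

lemma has_bochner_integral_indicator_Ico:
  "has_bochner_integral lborel (indicator {a..<b::real} :: real \<Rightarrow> real) (max 0 (b - a))"
proof (cases "a \<le> b")
  case True
  then show ?thesis by (auto simp: has_bochner_integral_iff)
next
  case False
  then have "{a..<b} = {}" by simp
  then have "(indicator {a..<b} :: real \<Rightarrow> real) = (\<lambda>_. 0)" by auto
  with False show ?thesis using has_bochner_integral_zero[of lborel] by (simp add: max_def)
qed

text \<open>
  The indicator of the arc of length \<open>a\<close> starting at \<open>x\<close>, on the circle obtained by glueing the
  ends of \<open>{0..<1}\<close>.
\<close>

definition arc_ind :: "real \<Rightarrow> real \<Rightarrow> real \<Rightarrow> real" where
  "arc_ind a x t = indicator {x..<min 1 (x + a)} t + indicator {0..<x + a - 1} t"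

lemma has_bochner_integral_arc_ind:
  assumes "0 \<le> a" "a \<le> 1" "0 \<le> x" "x < 1"
  shows "has_bochner_integral lborel (arc_ind a x) a"
proof -
  have "has_bochner_integral lborel (arc_ind a x) (max 0 (min 1 (x + a) - x) + max 0 (x + a - 1 - 0))"
    unfolding arc_ind_def by (intro has_bochner_integral_add has_bochner_integral_indicator_Ico)
  moreover have "max 0 (min 1 (x + a) - x) + max 0 (x + a - 1 - 0) = a"
    using assms by auto
  ultimately show ?thesis by simp
qed

text \<open>The pieces are the overlap of the unwrapped parts, the wrapped part of the later arc
  meeting the earlier arc, and the overlap of both wrapped parts. The fourth product vanishes
  because \<open>y + a - 1 \<le> x\<close>.\<close>

lemma arc_ind_mult:
  assumes "a \<le> 1" "0 \<le> y" "y \<le> x" "x < 1"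
  shows "arc_ind a x t * arc_ind a y t =
    indicator {x..<min 1 (y + a)} t + indicator {y..<x + a - 1} t + indicator {0..<y + a - 1} t"
  using assms unfolding arc_ind_def by (auto simp: indicator_def)

lemma has_bochner_integral_arc_ind_mult:
  assumes "0 \<le> a" "a \<le> 1" "0 \<le> x" "x < 1" "0 \<le> y" "y < 1"
  shows "has_bochner_integral lborel (\<lambda>t. arc_ind a x t * arc_ind a y t) (tent a \<bar>x - y\<bar>)"
  using assms(3-)
proof (induction x y rule: linorder_wlog)
  case (sym y x)
  then show ?case by (simp add: mult.commute abs_minus_commute)
next
  case (le y x)
  have "has_bochner_integral lborel
      (\<lambda>t. indicator {x..<min 1 (y + a)} t + indicator {y..<x + a - 1} t + indicator {0..<y + a - 1} t :: real)
      (max 0 (min 1 (y + a) - x) + max 0 (x + a - 1 - y) + max 0 (y + a - 1 - 0))"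
    by (intro has_bochner_integral_add has_bochner_integral_indicator_Ico)
  \<comment> \<open>The first and third pieces together have length
    \<open>max 0 (a - (x - y))\<close>; the second is the overlap the other way round the
    circle.\<close>
  moreover have "max 0 (min 1 (y + a) - x) + max 0 (x + a - 1 - y) + max 0 (y + a - 1 - 0) = tent a \<bar>x - y\<bar>"
    using le assms(1,2) by (auto simp: tent_def)
  ultimately show ?case
    using le assms(1,2) by (simp add: arc_ind_mult mult.commute)
qed

lemma arc_ind_eq_0: "0 \<le> x \<Longrightarrow> a \<le> 1 \<Longrightarrow> x < 1 \<Longrightarrow> t \<notin> {0..<1} \<Longrightarrow> arc_ind a x t = 0"
  by (auto simp: arc_ind_def)

text \<open>
  The double sum is the squared \<open>L\<^sup>2\<close> norm of the sum of the weighted arcs, so this is the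
  Cauchy--Schwarz inequality on the circle.
\<close>

lemma tent_kernel_ge:
  assumes fin: "finite W" and a: "0 \<le> a" "a \<le> 1" and p: "\<And>x. x \<in> W \<Longrightarrow> p x \<in> {0..<1}"
  shows "a\<^sup>2 * (\<Sum>x\<in>W. v x)\<^sup>2 \<le> (\<Sum>x\<in>W. \<Sum>y\<in>W. v x * v y * tent a \<bar>p x - p y\<bar>)"
proof -
  define g where "g t = (\<Sum>x\<in>W. v x * arc_ind a (p x) t)" for t
  define c where "c = a * (\<Sum>x\<in>W. v x)"
  have gg: "has_bochner_integral lborel (\<lambda>t. g t * g t)
      (\<Sum>x\<in>W. \<Sum>y\<in>W. v x * v y * tent a \<bar>p x - p y\<bar>)"
  proof -
    have "has_bochner_integral lborel
        (\<lambda>t. \<Sum>x\<in>W. \<Sum>y\<in>W. v x * v y * (arc_ind a (p x) t * arc_ind a (p y) t))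
        (\<Sum>x\<in>W. \<Sum>y\<in>W. v x * v y * tent a \<bar>p x - p y\<bar>)"
      using p a by (intro has_bochner_integral_sum has_bochner_integral_mult_right
          has_bochner_integral_arc_ind_mult) auto
    then show ?thesis by (simp add: g_def sum_product mult_ac)
  qed
  have g: "has_bochner_integral lborel g c"
  proof -
    have "has_bochner_integral lborel g (\<Sum>x\<in>W. v x * a)"
      unfolding g_def using p a
      by (intro has_bochner_integral_sum has_bochner_integral_mult_right
        has_bochner_integral_arc_ind) auto
    then show ?thesis by (simp add: c_def sum_distrib_left mult.commute)
  qed
  have g0: "g t = 0" if "t \<notin> {0..<1}" for t
    unfolding g_def using p a that by (intro sum.neutral) (auto simp: arc_ind_eq_0)
  have one: "has_bochner_integral lborel (indicator {0..<1::real}) (1::real)"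
    using has_bochner_integral_indicator_Ico[of 0 1] by simp
  \<comment> \<open>The integrand is \<open>(g t - c)\<^sup>2\<close> on \<open>{0..<1}\<close> and
    0 elsewhere, where \<open>c\<close> is the mean of \<open>g\<close>; the indicator keeps the
    constant term integrable.\<close>
  have "has_bochner_integral lborel (\<lambda>t. g t * g t - 2 * c * g t + c\<^sup>2 * indicator {0..<1} t)
      ((\<Sum>x\<in>W. \<Sum>y\<in>W. v x * v y * tent a \<bar>p x - p y\<bar>) - 2 * c * c + c\<^sup>2 * 1)"
    by (intro has_bochner_integral_add has_bochner_integral_diff has_bochner_integral_mult_right gg g one)
  moreover have "0 \<le> g t * g t - 2 * c * g t + c\<^sup>2 * indicator {0..<1} t" for t
  proof (cases "t \<in> {0..<1}")
    case True
    have "0 \<le> (g t - c)\<^sup>2" by simp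
    with True show ?thesis by (simp add: power2_eq_square algebra_simps)
  qed (simp add: g0)
  ultimately have "0 \<le> (\<Sum>x\<in>W. \<Sum>y\<in>W. v x * v y * tent a \<bar>p x - p y\<bar>) - 2 * c * c + c\<^sup>2 * 1"
    unfolding has_bochner_integral_iff by (elim conjE subst) (rule Bochner_Integration.integral_nonneg)
  then show ?thesis by (simp add: c_def power2_eq_square algebra_simps)
qed

text \<open>The value is the constant \<open>a\<^sup>2\<close> of \<open>tent_kernel_ge\<close>.
  This match turns the bounds for single tents into a bound by the integral of their
  combination.\<close>

lemma has_integral_tent:
  assumes "0 \<le> a" "a \<le> 1"
  shows "(tent a has_integral a\<^sup>2) {0..1}"
proof -
  have left: "((\<lambda>s. max 0 (a - s)) has_integral a\<^sup>2 / 2) {0..1}"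
  proof -
    have "((\<lambda>s. a - s) has_integral (a * a - a\<^sup>2 / 2) - (a * 0 - 0\<^sup>2 / 2)) {0..a}"
      using assms by (intro fundamental_theorem_of_calculus)
       (auto intro!: derivative_eq_intros simp flip: has_real_derivative_iff_has_vector_derivative)
    then have 1: "((\<lambda>s. max 0 (a - s)) has_integral a\<^sup>2 / 2) {0..a}"
      by (rule has_integral_eq_rhs[OF has_integral_eq[rotated]]) (auto simp: power2_eq_square)
    have "((\<lambda>s. max 0 (a - s)) has_integral 0) {a..1}"
      by (rule has_integral_eq[OF _ has_integral_0]) auto
    from has_integral_combine[OF assms 1 this] show ?thesis by simp
  qed
  have "((\<lambda>s. max 0 (a - (1 - s))) has_integral a\<^sup>2 / 2) {0..1}"
    using has_integral_affinity[of "\<lambda>s. max 0 (a - s)" "a\<^sup>2 / 2" 0 1 "-1" 1] left by simp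
  from has_integral_add[OF left this] show ?thesis
    by (simp add: tent_def[abs_def])
qed

text \<open>The tent interpolation of \<open>f\<close> at the occurring distances leaves the
  quadratic form unchanged, while its integral is at least that of \<open>f\<close> because it lies
  above \<open>f\<close>. For the interpolation, \<open>tent_kernel_ge\<close> applies term by term,
  and the constant \<open>c\<close> contributes exactly \<open>c\<close> times the squared
  sum.\<close>

lemma convex_kernel_ge:
  fixes f :: "real \<Rightarrow> real"
  assumes fin: "finite W" and p: "\<And>x. x \<in> W \<Longrightarrow> p x \<in> {0..<1}"
    and conv: "convex_on {0..1/2} f"
    and anti: "\<And>x y. 0 \<le> x \<Longrightarrow> x \<le> y \<Longrightarrow> y \<le> 1/2 \<Longrightarrow> f y \<le> f x"
    and symm: "\<And>s. f (1 - s) = f s"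
    and integrable: "f integrable_on {0..1}"
  shows "integral {0..1} f * (\<Sum>x\<in>W. v x)\<^sup>2 \<le> (\<Sum>x\<in>W. \<Sum>y\<in>W. v x * v y * f \<bar>p x - p y\<bar>)"
proof (cases "W = {}")
  case False
  \<comment> \<open>Folding replaces an arc by the shorter of the two complementary arcs, which
    brings all distances into \<open>{0..1/2}\<close>, where \<open>f\<close> is convex.\<close>
  define wrap where "wrap s = min s (1 - s :: real)" for s
  define S where "S = (\<lambda>(x, y). wrap \<bar>p x - p y\<bar>) ` (W \<times> W)"
  have f_wrap: "f (wrap s) = f s" for s by (simp add: wrap_def min_def symm)
  have absp: "0 \<le> \<bar>p x - p y\<bar> \<and> \<bar>p x - p y\<bar> \<le> 1" if "x \<in> W" "y \<in> W" for x y
    using p[OF that(1)] p[OF that(2)] by auto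
  have "wrap s \<in> {0..1/2}" if "0 \<le> s \<and> s \<le> 1" for s
    using that by (auto simp: wrap_def min_def)
  then have S: "finite S" "S \<noteq> {}" "S \<subseteq> {0..1/2}"
    using fin False absp by (auto simp: S_def simp del: atLeastAtMost_iff)
  \<comment> \<open>The diagonal pairs put 0 into \<open>S\<close>, so the interpolation dominates
    \<open>f\<close> on all of \<open>{0..1/2}\<close>.\<close>
  have "0 \<in> S"
  proof -
    obtain x where "x \<in> W" using False by blast
    then show ?thesis unfolding S_def by (intro image_eqI[of _ _ "(x, x)"]) (auto simp: wrap_def)
  qed
  then have Min: "Min S = 0" using S by (intro Min_eqI) auto
  have "\<exists>c a. (\<forall>t\<in>S. 0 \<le> a t) \<and>
      (\<forall>s\<in>S. f s = c + (\<Sum>t\<in>S. a t * max 0 (t - s))) \<and>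
      (\<forall>s\<in>{Min S..1/2}. f s \<le> c + (\<Sum>t\<in>S. a t * max 0 (t - s)))"
    by (rule convex_tent_interpolation[OF S conv]) (rule anti)
  then obtain c a where "\<forall>t\<in>S. 0 \<le> a t"
    and "\<forall>s\<in>S. f s = c + (\<Sum>t\<in>S. a t * max 0 (t - s))"
    and "\<forall>s\<in>{0..1/2}. f s \<le> c + (\<Sum>t\<in>S. a t * max 0 (t - s))"
    unfolding Min by blast
  note a = bspec[OF this(1)] and eq = bspec[OF this(2)] and ge = bspec[OF this(3)]
  \<comment> \<open>As \<open>t \<le> 1/2\<close>, at most one of the two summands of
    \<open>tent t s\<close> is nonzero, and it is the one for the shorter arc.\<close>
  have tent_wrap: "max 0 (t - wrap s) = tent t s" if "t \<in> S" for t s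
    using S(3) that by (auto simp: tent_def wrap_def subset_iff)
  have "integral {0..1} f \<le> c + (\<Sum>t\<in>S. a t * t\<^sup>2)"
  proof (rule has_integral_le)
    show "(f has_integral integral {0..1} f) {0..1}" using integrable by (rule integrable_integral)
    have "((\<lambda>s. c + (\<Sum>t\<in>S. a t * tent t s)) has_integral (1 - 0) *\<^sub>R c + (\<Sum>t\<in>S. a t * t\<^sup>2)) {0..1}"
    proof (intro has_integral_add has_integral_sum S(1) has_integral_mult_right)
      show "((\<lambda>_::real. c) has_integral (1 - 0) *\<^sub>R c) {0..1}"
        using has_integral_const_real[of c 0 1] by simp
      show "(tent t has_integral t\<^sup>2) {0..1}" if "t \<in> S" for t
        using S(3) that by (intro has_integral_tent) auto
    qed
    then show "((\<lambda>s. c + (\<Sum>t\<in>S. a t * tent t s)) has_integral c + (\<Sum>t\<in>S. a t * t\<^sup>2)) {0..1}"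
      by simp
    fix s :: real assume "s \<in> {0..1}"
    then have "f (wrap s) \<le> c + (\<Sum>t\<in>S. a t * max 0 (t - wrap s))"
      by (intro ge) (auto simp: wrap_def min_def)
    then show "f s \<le> c + (\<Sum>t\<in>S. a t * tent t s)" by (simp add: f_wrap tent_wrap)
  qed
  then have "integral {0..1} f * (\<Sum>x\<in>W. v x)\<^sup>2 \<le> (c + (\<Sum>t\<in>S. a t * t\<^sup>2)) * (\<Sum>x\<in>W. v x)\<^sup>2"
    by (intro mult_right_mono) auto
  also have "\<dots> = c * (\<Sum>x\<in>W. v x)\<^sup>2 + (\<Sum>t\<in>S. a t * (t\<^sup>2 * (\<Sum>x\<in>W. v x)\<^sup>2))"
    by (simp add: distrib_right sum_distrib_right mult.assoc)
  also have "\<dots> \<le> c * (\<Sum>x\<in>W. v x)\<^sup>2 + (\<Sum>t\<in>S. a t * (\<Sum>x\<in>W. \<Sum>y\<in>W. v x * v y * tent t \<bar>p x - p y\<bar>))"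
    using S(3) by (intro add_left_mono sum_mono mult_left_mono a tent_kernel_ge fin p) auto
  also have "\<dots> = (\<Sum>x\<in>W. \<Sum>y\<in>W. v x * v y * c) +
      (\<Sum>x\<in>W. \<Sum>y\<in>W. v x * v y * (\<Sum>t\<in>S. a t * tent t \<bar>p x - p y\<bar>))"
  proof -
    have "(\<Sum>t\<in>S. a t * (\<Sum>x\<in>W. \<Sum>y\<in>W. v x * v y * tent t \<bar>p x - p y\<bar>)) =
        (\<Sum>t\<in>S. \<Sum>x\<in>W. \<Sum>y\<in>W. v x * v y * (a t * tent t \<bar>p x - p y\<bar>))"
      by (simp add: sum_distrib_left mult_ac)
    also have "\<dots> = (\<Sum>x\<in>W. \<Sum>t\<in>S. \<Sum>y\<in>W. v x * v y * (a t * tent t \<bar>p x - p y\<bar>))"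
      by (rule sum.swap)
    also have "\<dots> = (\<Sum>x\<in>W. \<Sum>y\<in>W. \<Sum>t\<in>S. v x * v y * (a t * tent t \<bar>p x - p y\<bar>))"
      by (intro sum.cong refl sum.swap)
    moreover have "c * (\<Sum>x\<in>W. v x)\<^sup>2 = (\<Sum>x\<in>W. \<Sum>y\<in>W. v x * v y * c)"
      unfolding power2_eq_square sum_product unfolding sum_distrib_left by (simp add: mult_ac)
    ultimately show ?thesis by (simp add: sum_distrib_left)
  qed
  also have "\<dots> = (\<Sum>x\<in>W. \<Sum>y\<in>W. v x * v y * f \<bar>p x - p y\<bar>)"
    unfolding sum.distrib[symmetric] distrib_left[symmetric]
  proof (intro sum.cong refl)
    fix x y assume "x \<in> W" "y \<in> W"
    then have "wrap \<bar>p x - p y\<bar> \<in> S" by (auto simp: S_def)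
    from eq[OF this] show "v x * v y * (c + (\<Sum>t\<in>S. a t * tent t \<bar>p x - p y\<bar>)) = v x * v y * f \<bar>p x - p y\<bar>"
      by (simp add: f_wrap tent_wrap)
  qed
  finally show ?thesis .
qed simp

section \<open>Solvability of finite linear systems\<close>

text \<open>Gaussian elimination, one unknown per induction step: either back substitution yields a
  solution, or some combination of the rows reads 0 = 1.\<close>

lemma Fredholm_alternative_sum:
  fixes M :: "'a \<Rightarrow> 'b \<Rightarrow> 'c::field"
  assumes "finite K" "finite W"
  shows "(\<exists>w. \<forall>x\<in>W. (\<Sum>k\<in>K. M x k * w k) = b x) \<or>
    (\<exists>v. (\<forall>k\<in>K. (\<Sum>x\<in>W. v x * M x k) = 0) \<and> (\<Sum>x\<in>W. v x * b x) = 1)"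
  using assms(1)
proof (induction K arbitrary: M b rule: finite_induct)
  case empty
  show ?case
  proof (cases "\<forall>x\<in>W. b x = 0")
    case False
    then obtain x where x: "x \<in> W" "b x \<noteq> 0" by blast
    then have "(\<Sum>y\<in>W. (if y = x then 1 / b x else 0) * b y) = 1"
      using assms(2) by (simp add: if_distrib[of "\<lambda>z. z * _"] cong: if_cong)
    then show ?thesis by auto
  qed auto
next
  case (insert k K)
  show ?case
  proof (cases "\<forall>x\<in>W. M x k = 0")
    case True
    from insert.IH[of M b] show ?thesis
      using True insert.hyps by auto
  next
    case False
    then obtain p where p: "p \<in> W" "M p k \<noteq> 0" by blast
    \<comment> \<open>Subtracting \<open>r x\<close> times the pivot row \<open>p\<close> clears
      column \<open>k\<close>; row \<open>p\<close> itself becomes zero.\<close>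
    define r where "r x = M x k / M p k" for x
    define M' where "M' x j = M x j - r x * M p j" for x j
    define b' where "b' x = b x - r x * b p" for x
    from insert.IH[of M' b'] show ?thesis
    proof
      assume "\<exists>w. \<forall>x\<in>W. (\<Sum>j\<in>K. M' x j * w j) = b' x"
      then obtain w where w: "\<And>x. x \<in> W \<Longrightarrow> (\<Sum>j\<in>K. M' x j * w j) = b' x" by blast
      define wk where "wk = (b p - (\<Sum>j\<in>K. M p j * w j)) / M p k"
      have "(\<Sum>j\<in>insert k K. M x j * (w(k := wk)) j) = b x" if "x \<in> W" for x
      proof -
        have "(\<Sum>j\<in>insert k K. M x j * (w(k := wk)) j) = M x k * wk + (\<Sum>j\<in>K. M x j * w j)"
          using insert.hyps by (auto intro!: sum.cong)
        also have "(\<Sum>j\<in>K. M x j * w j) = b' x + r x * (\<Sum>j\<in>K. M p j * w j)"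
          unfolding w[OF that, symmetric]
          by (simp add: M'_def algebra_simps sum.distrib sum_distrib_left sum_subtractf)
        finally show ?thesis using p by (simp add: b'_def r_def wk_def field_simps)
      qed
      then show ?thesis by blast
    next
      assume "\<exists>v. (\<forall>j\<in>K. (\<Sum>x\<in>W. v x * M' x j) = 0) \<and> (\<Sum>x\<in>W. v x * b' x) = 1"
      then obtain v where v: "\<And>j. j \<in> K \<Longrightarrow> (\<Sum>x\<in>W. v x * M' x j) = 0" "(\<Sum>x\<in>W. v x * b' x) = 1"
        by blast
      \<comment> \<open>Undoing the elimination: the multiples of row \<open>p\<close> that were
        subtracted are collected in the coefficient of \<open>p\<close>. Column \<open>k\<close>
        then cancels for every choice of \<open>v\<close>.\<close>
      define u where "u x = v x - (if x = p then (\<Sum>x\<in>W. v x * r x) else 0)" for x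
      have u: "(\<Sum>x\<in>W. u x * h x) = (\<Sum>x\<in>W. v x * (h x - r x * h p))" for h
      proof -
        have "(\<Sum>x\<in>W. u x * h x) = (\<Sum>x\<in>W. v x * h x) - (\<Sum>x\<in>W. v x * r x) * h p"
          using p assms(2)
          by (simp add: u_def left_diff_distrib sum_subtractf if_distrib[of "\<lambda>z. z * _"] cong: if_cong)
        then show ?thesis by (simp add: algebra_simps sum_subtractf sum_distrib_left)
      qed
      have "(\<Sum>x\<in>W. u x * M x k) = 0"
        unfolding u using p by (simp add: r_def)
      moreover have "(\<Sum>x\<in>W. u x * M x j) = 0" if "j \<in> K" for j
        unfolding u using v(1)[OF that] by (simp add: M'_def)
      moreover have "(\<Sum>x\<in>W. u x * b x) = 1"
        unfolding u using v(2) by (simp add: b'_def)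
      ultimately show ?thesis by blast
    qed
  qed
qed

section \<open>The kappa-metric\<close>

lemma D_kappa_zero [simp]: "D_kappa \<kappa> 0 = 0"
  by (simp add: D_kappa_def)

lemma D_kappa_reflect: "D_kappa \<kappa> (1 - s) = D_kappa \<kappa> s"
proof -
  have "sin (pi * (1 - s)) = sin (pi * s)"
    using sin_pi_minus[of "pi * s"] by (simp add: algebra_simps)
  then show ?thesis by (simp add: D_kappa_eq)
qed

lemma pi_mult_bounds:
  assumes "0 \<le> s" "s \<le> 1/2"
  shows "0 \<le> pi * s" "pi * s \<le> pi / 2"
  using assms mult_left_mono[OF assms(2), of pi] by auto

text \<open>At \<kappa> = 1 the function has a corner at 1/2, where the derivative formula
  degenerates. The arguments by derivatives therefore assume \<open>\<kappa> < 1\<close>, and this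
  identity settles the remaining case.\<close>

lemma D_kappa_one:
  assumes "0 \<le> s" "s \<le> 1/2"
  shows "D_kappa 1 s = s"
proof -
  have "arcsin (sin (pi * s)) = pi * s"
    using pi_mult_bounds[OF assms] pi_ge_zero by (intro arcsin_sin) linarith+
  then show ?thesis by (simp add: D_kappa_def)
qed

lemma continuous_on_D_kappa:
  assumes "\<kappa> \<le> 1"
  shows "continuous_on A (D_kappa \<kappa>)"
proof -
  consider "\<kappa> > 0" | "\<kappa> = 0" | "\<kappa> < 0" by linarith
  then show ?thesis
  proof cases
    case 1
    have "\<bar>sqrt \<kappa> * sin (pi * s)\<bar> \<le> 1" for s
      using 1 assms by (simp add: abs_mult mult_le_one)
    with 1 show ?thesis
      unfolding D_kappa_def[abs_def] by (auto intro!: continuous_intros simp: abs_le_iff minus_le_iff)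
  next
    case 2
    then show ?thesis unfolding D_kappa_def[abs_def] by (auto intro!: continuous_intros)
  next
    case 3
    then show ?thesis unfolding D_kappa_def[abs_def] by (auto intro!: continuous_intros)
  qed
qed

text \<open>In each case the factors \<open>sqrt \<kappa>\<close> or \<open>sqrt (-\<kappa>)\<close>
  cancel in the derivative of \<open>D_fun\<close>, so one formula serves all signs of
  \<kappa>.\<close>

lemma D_kappa_has_derivative:
  assumes "\<kappa> < 1"
  shows "(D_kappa \<kappa> has_real_derivative cos (pi * s) / sqrt (1 - \<kappa> * (sin (pi * s))\<^sup>2)) (at s)"
proof -
  have "((D_fun \<kappa>) has_real_derivative 1 / (pi * sqrt (1 - \<kappa> * u\<^sup>2))) (at u)" if "\<bar>u\<bar> \<le> 1" for u
  proof -
    consider "\<kappa> > 0" | "\<kappa> = 0" | "\<kappa> < 0" by linarith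
    then show ?thesis
    proof cases
      case 1
      have "\<bar>sqrt \<kappa> * u\<bar> \<le> sqrt \<kappa> * 1"
        using that 1 by (auto simp: abs_mult intro: mult_left_mono)
      then have *: "\<bar>sqrt \<kappa> * u\<bar> < 1" using assms by (simp add: order.strict_trans1)
      have "((\<lambda>u. arcsin (sqrt \<kappa> * u) / (sqrt \<kappa> * pi)) has_real_derivative
          inverse (sqrt (1 - (sqrt \<kappa> * u)\<^sup>2)) * sqrt \<kappa> / (sqrt \<kappa> * pi)) (at u)"
        using * 1 by (intro DERIV_cdivide DERIV_chain2[OF DERIV_arcsin])
          (auto intro!: derivative_eq_intros)
      then show ?thesis using 1 by (simp add: D_fun_def[abs_def] power_mult_distrib field_simps)
    next
      case 2
      then show ?thesis by (auto simp: D_fun_def[abs_def] intro!: derivative_eq_intros)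
    next
      case 3
      have "((\<lambda>u. arsinh (sqrt (-\<kappa>) * u) / (sqrt (-\<kappa>) * pi)) has_real_derivative
          1 / sqrt ((sqrt (-\<kappa>) * u)\<^sup>2 + 1) * sqrt (-\<kappa>) / (sqrt (-\<kappa>) * pi)) (at u)"
        by (intro DERIV_cdivide DERIV_chain2[OF arsinh_real_has_field_derivative])
          (auto intro!: derivative_eq_intros)
      then show ?thesis using 3 by (simp add: D_fun_def[abs_def] power_mult_distrib field_simps)
    qed
  qed
  then have "((\<lambda>s. D_fun \<kappa> (sin (pi * s))) has_real_derivative
      1 / (pi * sqrt (1 - \<kappa> * (sin (pi * s))\<^sup>2)) * (cos (pi * s) * pi)) (at s)"
    by (rule DERIV_chain2) (auto intro!: derivative_eq_intros)
  then show ?thesis by (simp add: D_kappa_eq[abs_def])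
qed

lemma one_minus_kappa_sin_pos:
  assumes "\<kappa> < (1::real)"
  shows "0 < 1 - \<kappa> * (sin x)\<^sup>2"
proof -
  have "\<kappa> * (sin x)\<^sup>2 \<le> max 0 \<kappa> * 1"
    by (intro mult_mono) (auto simp: abs_square_le_1)
  then show ?thesis using assms by (auto simp: max_def split: if_splits)
qed

context
  fixes \<kappa> :: real
  assumes kappa: "\<kappa> < 1"
begin

text \<open>With \<open>u = (sin (pi * s))\<^sup>2\<close> the derivative \<open>E\<close> satisfies
  \<open>E\<^sup>2 = (1 - u) / (1 - \<kappa> * u)\<close>, which is rational in \<open>u\<close>.
  For the last bound, \<open>0 \<le> E \<le> 1\<close> gives \<open>E\<^sup>2 \<le> E\<close>, so it
  suffices to bound \<open>E\<^sup>2\<close> below and use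
  \<open>u \<le> (pi * s)\<^sup>2\<close>.\<close>

lemma D_kappa_deriv_bounds:
  assumes "0 \<le> s" "s \<le> 1/2"
  shows "0 \<le> cos (pi * s) / sqrt (1 - \<kappa> * (sin (pi * s))\<^sup>2)"
    and "cos (pi * s) / sqrt (1 - \<kappa> * (sin (pi * s))\<^sup>2) \<le> 1"
    and "1 - (1 + \<bar>\<kappa>\<bar>) * (pi * s)\<^sup>2 \<le> cos (pi * s) / sqrt (1 - \<kappa> * (sin (pi * s))\<^sup>2)"
proof -
  define u where "u = (sin (pi * s))\<^sup>2"
  define E where "E = cos (pi * s) / sqrt (1 - \<kappa> * u)"
  have pos: "0 < 1 - \<kappa> * u" using one_minus_kappa_sin_pos[OF kappa] by (simp add: u_def)
  have u: "0 \<le> u" "u \<le> 1" by (auto simp: u_def abs_square_le_1)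
  have cos: "0 \<le> cos (pi * s)" using pi_mult_bounds[OF assms] pi_ge_zero by (intro cos_ge_zero) linarith+
  show E0: "0 \<le> cos (pi * s) / sqrt (1 - \<kappa> * (sin (pi * s))\<^sup>2)"
    using cos pos by (simp add: u_def)
  have E2: "E\<^sup>2 = (1 - u) / (1 - \<kappa> * u)"
    using pos by (simp add: E_def power_divide u_def cos_squared_eq)
  have "(1 - u) / (1 - \<kappa> * u) \<le> 1"
    using pos u mult_right_mono[of \<kappa> 1 u] kappa by simp
  then have E_le: "E \<le> 1"
    unfolding E2[symmetric] by (intro power2_le_imp_le[of E 1]) simp_all
  then show E1: "cos (pi * s) / sqrt (1 - \<kappa> * (sin (pi * s))\<^sup>2) \<le> 1"
    by (simp add: E_def u_def)
  have "(1 - (1 + \<bar>\<kappa>\<bar>) * u) * (1 - \<kappa> * u) \<le> 1 - u"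
  proof (cases "\<kappa> \<ge> 0")
    case True
    have "(1 - (1 + \<kappa>) * u) * (1 - \<kappa> * u) = (1 - u) - \<kappa> * u * ((1 - u) + (1 - \<kappa> * u))"
      by (simp add: algebra_simps)
    also have "\<dots> \<le> 1 - u" using True u pos by simp
    finally show ?thesis using True by simp
  next
    case False
    have "(1 - (1 - \<kappa>) * u) * (1 - \<kappa> * u) = (1 - u) + (1 - \<kappa>) * \<kappa> * u\<^sup>2"
      by (simp add: algebra_simps power2_eq_square)
    moreover have "(1 - \<kappa>) * \<kappa> * u\<^sup>2 \<le> 0" using False by (intro mult_nonpos_nonneg mult_nonneg_nonpos) auto
    ultimately show ?thesis using False by simp
  qed
  then have "1 - (1 + \<bar>\<kappa>\<bar>) * u \<le> E\<^sup>2"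
    using pos unfolding E2 by (simp add: pos_le_divide_eq)
  also have "E\<^sup>2 \<le> E" using E0 E_le unfolding u_def[symmetric] E_def[symmetric]
    by (simp add: power2_eq_square mult_left_le_one_le)
  finally have "1 - (1 + \<bar>\<kappa>\<bar>) * u \<le> E" .
  moreover have "(1 + \<bar>\<kappa>\<bar>) * u \<le> (1 + \<bar>\<kappa>\<bar>) * (pi * s)\<^sup>2"
    using abs_sin_x_le_abs_x[of "pi * s"] by (intro mult_left_mono) (auto simp: u_def abs_le_square_iff)
  ultimately show "1 - (1 + \<bar>\<kappa>\<bar>) * (pi * s)\<^sup>2 \<le> cos (pi * s) / sqrt (1 - \<kappa> * (sin (pi * s))\<^sup>2)"
    by (simp add: E_def u_def)
qed

text \<open>The squared derivative \<open>(1 - u) / (1 - \<kappa> * u)\<close> decreases in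
  \<open>u\<close> for \<open>\<kappa> < 1\<close>, and the sine increases up to
  \<open>pi / 2\<close>. This is the source of concavity.\<close>

lemma D_kappa_deriv_antimono:
  assumes "0 \<le> s" "s \<le> t" "t \<le> 1/2"
  shows "cos (pi * t) / sqrt (1 - \<kappa> * (sin (pi * t))\<^sup>2) \<le> cos (pi * s) / sqrt (1 - \<kappa> * (sin (pi * s))\<^sup>2)"
proof -
  define u v where "u = (sin (pi * s))\<^sup>2" and "v = (sin (pi * t))\<^sup>2"
  have pos: "0 < 1 - \<kappa> * u" "0 < 1 - \<kappa> * v"
    using one_minus_kappa_sin_pos[OF kappa] by (simp_all add: u_def v_def)
  have "sin (pi * s) \<le> sin (pi * t)"
    using assms pi_mult_bounds[of s] pi_mult_bounds[of t] pi_ge_zero mult_left_mono[of s t pi]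
    by (intro sin_monotone_2pi_le) linarith+
  then have "u \<le> v"
    unfolding u_def v_def using assms pi_mult_bounds[of s] pi_ge_zero
    by (intro power_mono sin_ge_zero) linarith+
  have "(1 - v) / (1 - \<kappa> * v) \<le> (1 - u) / (1 - \<kappa> * u)"
  proof -
    have "(1 - \<kappa>) * u \<le> (1 - \<kappa>) * v" using \<open>u \<le> v\<close> kappa by simp
    then have "(1 - v) * (1 - \<kappa> * u) \<le> (1 - u) * (1 - \<kappa> * v)" by (simp add: algebra_simps)
    then show ?thesis using pos by (simp add: pos_divide_le_eq pos_le_divide_eq)
  qed
  then have "(cos (pi * t) / sqrt (1 - \<kappa> * v))\<^sup>2 \<le> (cos (pi * s) / sqrt (1 - \<kappa> * u))\<^sup>2"
    using pos by (simp add: power_divide u_def v_def cos_squared_eq)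
  then show ?thesis
    unfolding u_def v_def
    by (rule power2_le_imp_le) (use D_kappa_deriv_bounds(1)[of s] assms in auto)
qed

end

lemma D_kappa_mono:
  assumes "\<kappa> \<le> 1" "0 \<le> s" "s \<le> t" "t \<le> 1/2"
  shows "D_kappa \<kappa> s \<le> D_kappa \<kappa> t"
proof (cases "\<kappa> = 1")
  case True
  then show ?thesis using assms by (simp add: D_kappa_one)
next
  case False
  then have "\<kappa> < 1" using assms by simp
  show ?thesis
  proof (rule DERIV_nonneg_imp_nondecreasing[OF assms(3)])
    fix x assume "s \<le> x" "x \<le> t"
    then show "\<exists>y. DERIV (D_kappa \<kappa>) x :> y \<and> y \<ge> 0"
      using D_kappa_has_derivative[OF \<open>\<kappa> < 1\<close>, of x] D_kappa_deriv_bounds(1)[OF \<open>\<kappa> < 1\<close>, of x] assms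
      by auto
  qed
qed

lemma convex_on_uminus_D_kappa:
  assumes "\<kappa> \<le> 1"
  shows "convex_on {0..1/2} (\<lambda>s. - D_kappa \<kappa> s)"
proof (cases "\<kappa> = 1")
  case True
  show ?thesis
  proof (rule convex_onI)
    fix t x y :: real
    assume *: "0 < t" "t < 1" "x \<in> {0..1/2}" "y \<in> {0..1/2}"
    have "(1 - t) *\<^sub>R x + t *\<^sub>R y \<in> {0..1/2}"
      using * by (intro convexD_alt) auto
    with * True show "- D_kappa \<kappa> ((1 - t) *\<^sub>R x + t *\<^sub>R y) \<le> (1 - t) * - D_kappa \<kappa> x + t * - D_kappa \<kappa> y"
      by (simp add: D_kappa_one)
  qed auto
next
  case False
  then have "\<kappa> < 1" using assms by simp
  show ?thesis
    by (rule convex_on_realI[where f' = "\<lambda>s. - (cos (pi * s) / sqrt (1 - \<kappa> * (sin (pi * s))\<^sup>2))"])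
      (auto intro!: DERIV_minus D_kappa_has_derivative D_kappa_deriv_antimono \<open>\<kappa> < 1\<close> simp del: minus_divide_left)
qed

lemma D_kappa_le:
  assumes "\<kappa> \<le> 1" "0 \<le> s" "s \<le> 1/2"
  shows "D_kappa \<kappa> s \<le> s"
proof (cases "\<kappa> = 1")
  case False
  then have "\<kappa> < 1" using assms by simp
  have "0 - D_kappa \<kappa> 0 \<le> s - D_kappa \<kappa> s"
  proof (rule DERIV_nonneg_imp_nondecreasing[OF assms(2)])
    fix x assume "0 \<le> x" "x \<le> s"
    then have "0 \<le> 1 - cos (pi * x) / sqrt (1 - \<kappa> * (sin (pi * x))\<^sup>2)"
      using D_kappa_deriv_bounds(2)[OF \<open>\<kappa> < 1\<close>, of x] assms by simp
    with DERIV_diff[OF DERIV_ident D_kappa_has_derivative[OF \<open>\<kappa> < 1\<close>, of x]]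
    show "\<exists>y. DERIV (\<lambda>x. x - D_kappa \<kappa> x) x :> y \<and> y \<ge> 0"
      by blast
  qed
  then show ?thesis by simp
qed (use assms in \<open>simp add: D_kappa_one\<close>)

text \<open>Integrating the lower bound for the derivative from 0 turns
  \<open>(1 + \<bar>\<kappa>\<bar>) * (pi * x)\<^sup>2\<close> into the cubic term, whence the
  divisor 3.\<close>

lemma D_kappa_ge_cubic:
  assumes "\<kappa> \<le> 1" "0 \<le> s" "s \<le> 1/2"
  shows "s - (1 + \<bar>\<kappa>\<bar>) * pi\<^sup>2 / 3 * s ^ 3 \<le> D_kappa \<kappa> s"
proof (cases "\<kappa> = 1")
  case False
  then have "\<kappa> < 1" using assms by simp
  define C where "C = (1 + \<bar>\<kappa>\<bar>) * pi\<^sup>2 / 3"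
  have "D_kappa \<kappa> 0 - 0 + C * 0 ^ 3 \<le> D_kappa \<kappa> s - s + C * s ^ 3"
  proof (rule DERIV_nonneg_imp_nondecreasing[OF assms(2)])
    fix x assume x: "0 \<le> x" "x \<le> s"
    have "DERIV (\<lambda>x. D_kappa \<kappa> x - x + C * x ^ 3) x :>
        cos (pi * x) / sqrt (1 - \<kappa> * (sin (pi * x))\<^sup>2) - 1 + C * (3 * x ^ 2)"
      by (intro DERIV_add DERIV_diff DERIV_ident D_kappa_has_derivative[OF \<open>\<kappa> < 1\<close>])
        (auto intro!: derivative_eq_intros)
    moreover have "0 \<le> cos (pi * x) / sqrt (1 - \<kappa> * (sin (pi * x))\<^sup>2) - 1 + C * (3 * x ^ 2)"
      using D_kappa_deriv_bounds(3)[OF \<open>\<kappa> < 1\<close>, of x] x assms(3)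
      by (simp add: C_def power_mult_distrib)
    ultimately show "\<exists>y. DERIV (\<lambda>x. D_kappa \<kappa> x - x + C * x ^ 3) x :> y \<and> y \<ge> 0"
      by blast
  qed
  then show ?thesis by (simp add: C_def)
qed (use assms in \<open>simp add: D_kappa_one\<close>)

lemma D_kappa_half_pos: "\<kappa> \<le> 1 \<Longrightarrow> 0 < D_kappa \<kappa> (1/2)"
  using D_fun_nonneg[of \<kappa> 1] D_fun_eq_0_iff[of \<kappa> 1] by (simp add: D_kappa_eq)

text \<open>A concave function lies above its chord, here from 0 to 1/2.\<close>

lemma D_kappa_ge_linear:
  assumes "\<kappa> \<le> 1" "0 \<le> s" "s \<le> 1/2"
  shows "2 * D_kappa \<kappa> (1/2) * s \<le> D_kappa \<kappa> s"
  using convex_on_cross_mult[OF convex_on_uminus_D_kappa[OF assms(1)], of 0 "1/2" s] assms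
  by (simp add: mult_ac)

lemma convex_on_exp_compose:
  fixes g :: "'a::real_vector \<Rightarrow> real"
  assumes "convex_on S g"
  shows "convex_on S (\<lambda>x. exp (g x))"
proof (rule convex_onI)
  fix t x y assume *: "0 < t" "t < (1::real)" "x \<in> S" "y \<in> S"
  have "convex_on UNIV (exp :: real \<Rightarrow> real)"
    by (rule convex_on_realI[where f' = exp]) (auto intro: DERIV_exp)
  have "exp (g ((1 - t) *\<^sub>R x + t *\<^sub>R y)) \<le> exp ((1 - t) * g x + t * g y)"
    using convex_onD[OF assms, of t x y] * by simp
  also have "\<dots> \<le> (1 - t) * exp (g x) + t * exp (g y)"
    using convex_onD[OF \<open>convex_on UNIV exp\<close>, of t "g x" "g y"] * by simp
  finally show "exp (g ((1 - t) *\<^sub>R x + t *\<^sub>R y)) \<le> (1 - t) * exp (g x) + t * exp (g y)" .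
qed (use assms convex_on_imp_convex in blast)

section \<open>The integral of \<open>exp (- L * D_kappa \<kappa> s)\<close> for large
  \<open>L\<close>\<close>

lemma integral_reflect_half:
  fixes f :: "real \<Rightarrow> real"
  assumes "f integrable_on {0..1}" and "\<And>s. f (1 - s) = f s"
  shows "integral {0..1} f = 2 * integral {0..1/2} f"
proof -
  have int: "f integrable_on {0..1/2}" by (rule integrable_subinterval_real[OF assms(1)]) auto
  then have "(f has_integral integral {0..1/2} f) {0..1/2}" by (rule integrable_integral)
  then have "((\<lambda>s. f (1 - s)) has_integral integral {0..1/2} f) {1/2..1}"
    using has_integral_affinity[of f "integral {0..1/2} f" 0 "1/2" "-1" 1] by simp
  then have "(f has_integral integral {0..1/2} f) {1/2..1}" by (simp add: assms(2))
  from has_integral_combine[OF _ _ integrable_integral[OF int] this]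
  show ?thesis by (simp add: integral_unique)
qed

lemma has_integral_exp_uminus:
  fixes b h :: real
  assumes "0 < b" "0 \<le> h"
  shows "((\<lambda>s. exp (- b * s)) has_integral (1 - exp (- b * h)) / b) {0..h}"
proof -
  have "((\<lambda>s. exp (- b * s)) has_integral (- exp (- b * h) / b) - (- exp (- b * 0) / b)) {0..h}"
    using assms by (intro fundamental_theorem_of_calculus)
      (auto intro!: derivative_eq_intros simp flip: has_real_derivative_iff_has_vector_derivative)
  then show ?thesis by (simp add: diff_divide_distrib)
qed

lemma integral_cube_exp_le:
  fixes b h :: real
  assumes "0 < b" "0 \<le> h"
  shows "integral {0..h} (\<lambda>s. s ^ 3 * exp (- b * s)) \<le> 6 / b ^ 4"
proof -
  \<comment> \<open>The antiderivative from repeated integration by parts; \<open>- G 0\<close> is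
    the integral over the whole half-line.\<close>
  define G where "G s = - exp (- b * s) * (s ^ 3 / b + 3 * s\<^sup>2 / b\<^sup>2 + 6 * s / b ^ 3 + 6 / b ^ 4)" for s
  have "(G has_real_derivative s ^ 3 * exp (- b * s)) (at s within A)" for s A
    unfolding G_def using assms(1)
    by (auto intro!: derivative_eq_intros simp: field_simps power2_eq_square power3_eq_cube power4_eq_xxxx)
  then have "((\<lambda>s. s ^ 3 * exp (- b * s)) has_integral G h - G 0) {0..h}"
    using assms(2) by (intro fundamental_theorem_of_calculus)
      (auto simp flip: has_real_derivative_iff_has_vector_derivative)
  moreover have "G h \<le> 0" using assms by (simp add: G_def)
  moreover have "G 0 = - (6 / b ^ 4)" by (simp add: G_def)
  ultimately show ?thesis by (simp add: integral_unique)
qed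

context
  fixes \<kappa> :: real
  assumes kappa: "\<kappa> \<le> 1"
begin

lemma integrable_exp_D_kappa: "(\<lambda>s. exp (- L * D_kappa \<kappa> s)) integrable_on {a..b}"
  by (intro integrable_continuous_real continuous_intros continuous_on_D_kappa kappa)

lemma integral_exp_D_kappa_half:
  "integral {0..1} (\<lambda>s. exp (- L * D_kappa \<kappa> s)) = 2 * integral {0..1/2} (\<lambda>s. exp (- L * D_kappa \<kappa> s))"
  by (rule integral_reflect_half[OF integrable_exp_D_kappa]) (simp add: D_kappa_reflect)

lemma integral_exp_D_kappa_ge:
  assumes "0 < L"
  shows "2 / L * (1 - exp (- L / 2)) \<le> integral {0..1} (\<lambda>s. exp (- L * D_kappa \<kappa> s))"
proof -
  have "(1 - exp (- L * (1/2))) / L \<le> integral {0..1/2} (\<lambda>s. exp (- L * D_kappa \<kappa> s))"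
    using assms kappa
    by (intro has_integral_le[OF has_integral_exp_uminus integrable_integral[OF integrable_exp_D_kappa]])
      (auto intro: D_kappa_le)
  moreover have "2 / L * (1 - exp (- L / 2)) = 2 * ((1 - exp (- L * (1/2))) / L)" by simp
  ultimately show ?thesis unfolding integral_exp_D_kappa_half by linarith
qed

text \<open>With \<open>a = L * D_kappa \<kappa> s\<close>, the inequality 1 + x \<le> exp x bounds
  \<open>exp (- a) - exp (- L * s)\<close> by \<open>(L * s - a) * exp (- a)\<close>. The first
  factor is at most \<open>L * C * s ^ 3\<close> by the cubic bound; the second is at most
  \<open>exp (- (L * c) * s)\<close> by the chord bound, which gives decay on the whole half period.
  Integration leaves \<open>L * C * (6 / (L * c) ^ 4)\<close>, which is
  \<open>K / L ^ 3\<close>.\<close>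

lemma integral_exp_D_kappa_le:
  defines "K \<equiv> 6 * ((1 + \<bar>\<kappa>\<bar>) * pi\<^sup>2 / 3) / (2 * D_kappa \<kappa> (1/2)) ^ 4"
  assumes "0 < L"
  shows "integral {0..1} (\<lambda>s. exp (- L * D_kappa \<kappa> s)) \<le> 2 / L + 2 * K / L ^ 3"
proof -
  define C where "C = (1 + \<bar>\<kappa>\<bar>) * pi\<^sup>2 / 3"
  define c where "c = 2 * D_kappa \<kappa> (1/2)"
  have c: "0 < c" using D_kappa_half_pos[OF kappa] by (simp add: c_def)
  have C: "0 \<le> C" by (simp add: C_def)
  have le: "exp (- L * D_kappa \<kappa> s) \<le> exp (- L * s) + L * C * (s ^ 3 * exp (- (L * c) * s))"
    if s: "s \<in> {0..1/2}" for s
  proof -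
    define a where "a = L * D_kappa \<kappa> s"
    have "1 - (L * s - a) \<le> exp (- (L * s - a))"
      using exp_ge_add_one_self[of "- (L * s - a)"] by linarith
    then have "exp (- a) * (1 - (L * s - a)) \<le> exp (- a) * exp (- (L * s - a))" by simp
    also have "\<dots> = exp (- L * s)" by (simp flip: exp_add)
    finally have 1: "exp (- a) \<le> exp (- L * s) + (L * s - a) * exp (- a)"
      by (simp add: algebra_simps)
    have "L * (s - D_kappa \<kappa> s) \<le> L * (C * s ^ 3)"
      using D_kappa_ge_cubic[OF kappa, of s] s assms by (intro mult_left_mono) (auto simp: C_def)
    then have 2: "L * s - a \<le> L * C * s ^ 3" by (simp add: a_def algebra_simps)
    have "L * (c * s) \<le> a"
      unfolding a_def c_def using D_kappa_ge_linear[OF kappa, of s] s assms by (intro mult_left_mono) auto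
    then have "exp (- a) \<le> exp (- (L * c) * s)" by (simp add: mult.assoc)
    then have "(L * s - a) * exp (- a) \<le> L * C * s ^ 3 * exp (- (L * c) * s)"
      using 2 s C assms by (intro mult_mono) auto
    with 1 show ?thesis by (simp add: a_def mult.assoc)
  qed
  have I1: "(\<lambda>s. s ^ 3 * exp (- (L * c) * s)) integrable_on {0..1/2}"
    by (intro integrable_continuous_real continuous_intros)
  have "integral {0..1/2} (\<lambda>s. exp (- L * D_kappa \<kappa> s)) \<le>
      (1 - exp (- L * (1/2))) / L + L * C * integral {0..1/2} (\<lambda>s. s ^ 3 * exp (- (L * c) * s))"
    using assms
    by (intro has_integral_le[OF integrable_integral[OF integrable_exp_D_kappa]
        has_integral_add[OF has_integral_exp_uminus has_integral_mult_right[OF integrable_integral[OF I1]]] le]) auto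
  also have "\<dots> \<le> 1 / L + L * C * (6 / (L * c) ^ 4)"
    using assms c C by (intro add_mono mult_left_mono integral_cube_exp_le divide_right_mono) auto
  also have "\<dots> = 1 / L + K / L ^ 3"
    using assms c unfolding K_def C_def[symmetric] c_def[symmetric]
    by (simp add: field_simps power_mult_distrib eval_nat_numeral)
  finally show ?thesis unfolding integral_exp_D_kappa_half by simp
qed

lemma inverse_integral_exp_D_kappa_asymp:
  "\<exists>B. \<forall>L>0. \<bar>inverse (integral {0..1} (\<lambda>s. exp (- L * D_kappa \<kappa> s))) - L / 2\<bar> \<le> B / L"
proof -
  define K where "K = 6 * ((1 + \<bar>\<kappa>\<bar>) * pi\<^sup>2 / 3) / (2 * D_kappa \<kappa> (1/2)) ^ 4"
  have K: "0 \<le> K" using D_kappa_half_pos[OF kappa] by (simp add: K_def)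
  \<comment> \<open>The 4 comes from the upper bound for the inverse, \<open>K\<close> from the
    lower one.\<close>
  have "\<bar>inverse (integral {0..1} (\<lambda>s. exp (- L * D_kappa \<kappa> s))) - L / 2\<bar> \<le> (4 + K) / L" if L: "0 < L" for L
  proof -
    define I where "I = integral {0..1} (\<lambda>s. exp (- L * D_kappa \<kappa> s))"
    \<comment> \<open>Replacing the exponential by a rational bound makes the lower bound for
      \<open>I\<close> equal \<open>2 * L / (8 + L\<^sup>2)\<close>, whose inverse is exactly
      \<open>L / 2 + 4 / L\<close>.\<close>
    have "1 + (L / 2)\<^sup>2 / 2 \<le> exp (L / 2)"
      using exp_lower_Taylor_quadratic[of "L / 2"] L by simp
    then have "inverse (exp (L / 2)) \<le> inverse (1 + (L / 2)\<^sup>2 / 2)"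
      by (intro le_imp_inverse_le) (auto intro: add_pos_nonneg)
    then have "exp (- L / 2) \<le> inverse (1 + (L / 2)\<^sup>2 / 2)"
      by (simp add: exp_minus)
    also have "\<dots> = 8 / (8 + L\<^sup>2)" by (simp add: field_simps)
    finally have "2 / L * (1 - 8 / (8 + L\<^sup>2)) \<le> 2 / L * (1 - exp (- L / 2))"
      using L by (intro mult_left_mono) auto
    also have "\<dots> \<le> I" unfolding I_def by (rule integral_exp_D_kappa_ge[OF L])
    finally have ge: "2 / L * (1 - 8 / (8 + L\<^sup>2)) \<le> I" .
    have p: "8 + L\<^sup>2 > 0" by (intro add_pos_nonneg) auto
    have "2 / L * (1 - 8 / (8 + L\<^sup>2)) = 2 * L / (8 + L\<^sup>2)"
      using L p by (simp add: field_simps power2_eq_square)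
    with ge have ge: "2 * L / (8 + L\<^sup>2) \<le> I" by simp
    have pos: "0 < 2 * L / (8 + L\<^sup>2)" using L p by simp
    have "inverse I \<le> inverse (2 * L / (8 + L\<^sup>2))" using ge pos by (rule le_imp_inverse_le)
    also have "\<dots> = L / 2 + 4 / L" using L p by (simp add: field_simps power2_eq_square)
    finally have up: "inverse I \<le> L / 2 + 4 / L" .
    have "I \<le> 2 / L + 2 * K / L ^ 3"
      unfolding I_def K_def by (rule integral_exp_D_kappa_le[OF L])
    then have "inverse (2 / L + 2 * K / L ^ 3) \<le> inverse I"
      using ge pos by (intro le_imp_inverse_le) auto
    moreover have "L / 2 - K / (2 * L) \<le> inverse (2 / L + 2 * K / L ^ 3)"
    proof -
      have q: "0 < 2 / L + 2 * K / L ^ 3" using L K by (intro add_pos_nonneg) auto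
      \<comment> \<open>The factors are \<open>L / 2 * (1 - K / L\<^sup>2)\<close> and
        \<open>2 / L * (1 + K / L\<^sup>2)\<close>, so the product is a difference of
        squares.\<close>
      have "(L / 2 - K / (2 * L)) * (2 / L + 2 * K / L ^ 3) = 1 - (K / L\<^sup>2)\<^sup>2"
        using L by (simp add: field_simps eval_nat_numeral)
      then have "(L / 2 - K / (2 * L)) * (2 / L + 2 * K / L ^ 3) \<le> 1" by simp
      with q show ?thesis by (simp add: inverse_eq_divide pos_le_divide_eq)
    qed
    ultimately have "L / 2 - K / (2 * L) \<le> inverse I" by simp
    moreover have "K / (2 * L) \<le> K / L" "0 \<le> K / L" "0 \<le> 4 / L" using L K by (auto simp: field_simps)
    ultimately show ?thesis using up unfolding I_def[symmetric] by (simp add: abs_le_iff add_divide_distrib)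
  qed
  then show ?thesis by blast
qed

end

section \<open>Magnitude\<close>

text \<open>If the weighting equations had no solution, some \<open>v\<close> of sum 1 would be
  annihilated by the matrix. Its quadratic form would be 0, against the lower bound
  \<open>I\<close>.\<close>

lemma weighting_exists:
  assumes fin: "finite (mspace m)" and I: "0 < I"
    and ge: "\<And>v. I * (\<Sum>x\<in>mspace m. v x)\<^sup>2 \<le>
      (\<Sum>x\<in>mspace m. \<Sum>y\<in>mspace m. v x * v y * exp (- mdist m x y))"
  shows "\<exists>w. weighting m w"
proof (rule ccontr)
  assume "\<nexists>w. weighting m w"
  then obtain v where v: "\<And>y. y \<in> mspace m \<Longrightarrow> (\<Sum>x\<in>mspace m. v x * exp (- mdist m x y)) = 0"
    and sum: "(\<Sum>x\<in>mspace m. v x) = 1"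
    using Fredholm_alternative_sum[OF fin fin, of "\<lambda>x y. exp (- mdist m x y)" "\<lambda>_. 1"]
    unfolding weighting_def by auto
  have "(\<Sum>x\<in>mspace m. \<Sum>y\<in>mspace m. v x * v y * exp (- mdist m x y)) =
      (\<Sum>y\<in>mspace m. v y * (\<Sum>x\<in>mspace m. v x * exp (- mdist m x y)))"
    by (subst sum.swap) (simp add: sum_distrib_left mult_ac)
  also have "\<dots> = 0" by (simp add: v)
  finally show False using ge[of v] I sum by simp
qed

text \<open>At a weighting the quadratic form collapses to its sum \<open>r\<close>, so the
  hypothesis reads \<open>I * r\<^sup>2 \<le> r\<close>; for positive \<open>r\<close> one divides
  by \<open>r\<close>.\<close>

lemma finite_magnitude_le:
  assumes fin: "finite (mspace m)" and I: "0 < I"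
    and ge: "\<And>v. I * (\<Sum>x\<in>mspace m. v x)\<^sup>2 \<le>
      (\<Sum>x\<in>mspace m. \<Sum>y\<in>mspace m. v x * v y * exp (- mdist m x y))"
  shows "finite_magnitude m \<le> inverse I"
proof -
  obtain w where w: "weighting m w" using weighting_exists[OF assms] by blast
  define r where "r = (\<Sum>x\<in>mspace m. w x)"
  have "I * r\<^sup>2 \<le> (\<Sum>x\<in>mspace m. w x * (\<Sum>y\<in>mspace m. exp (- mdist m x y) * w y))"
    using ge[of w] by (simp add: r_def sum_distrib_left mult_ac)
  also have "\<dots> = r" using w by (simp add: weighting_def r_def)
  finally have "I * r * r \<le> 1 * r" by (simp add: power2_eq_square mult.assoc)
  moreover have "r \<le> inverse I" if "r \<le> 0" using that I by (meson inverse_nonnegative_iff_nonnegative order.strict_implies_order order_trans)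
  ultimately have "r \<le> inverse I"
    using I by (cases "r \<le> 0") (auto simp: mult_le_cancel_right inverse_eq_divide pos_le_divide_eq mult.commute)
  then show ?thesis using finite_magnitude_eq[OF w] by (simp add: r_def)
qed

section \<open>Riemann sums and equally spaced points\<close>

lemma Riemann_sum_tendsto:
  fixes f :: "real \<Rightarrow> real"
  assumes f: "continuous_on {0..1} f"
  shows "(\<lambda>n. (\<Sum>k<n. f (real k / real n)) / real n) \<longlonglongrightarrow> integral {0..1} f"
proof (rule LIMSEQ_I)
  fix e :: real assume e: "0 < e"
  have "uniformly_continuous_on {0..1} f"
    using f by (intro compact_uniformly_continuous) auto
  then obtain d where d: "0 < d" "\<And>x y. x \<in> {0..1} \<Longrightarrow> y \<in> {0..1} \<Longrightarrow> dist y x < d \<Longrightarrow> dist (f y) (f x) < e / 2"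
    unfolding uniformly_continuous_on_def using e by (metis half_gt_zero)
  have "norm ((\<Sum>k<n. f (real k / real n)) / real n - integral {0..1} f) < e" if n: "n > nat \<lceil>1 / d\<rceil>" for n
  proof -
    have n0: "0 < real n" using n by simp
    have "1 / d < real n" using n by linarith
    then have nd: "1 / real n < d" using d(1) n0 by (simp add: field_simps)
    \<comment> \<open>Induction over the cells: each has width below the modulus \<open>d\<close>
      and adds at most \<open>e / 2\<close> times its width to the error.\<close>
    have "\<bar>(\<Sum>k<m. f (real k / real n)) / real n - integral {0..real m / real n} f\<bar> \<le> real m / real n * (e / 2)"
      if "m \<le> n" for m
      using that
    proof (induction m)
      case (Suc m)
      define a b where "a = real m / real n" and "b = real (Suc m) / real n"
      have ab: "0 \<le> a" "a \<le> b" "b \<le> 1" "b - a = 1 / real n"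
        using n0 Suc.prems by (auto simp: a_def b_def field_simps)
      have int: "f integrable_on {x..y}" if "0 \<le> x" "y \<le> 1" for x y
        using that by (intro integrable_continuous_real continuous_on_subset[OF f]) auto
      have "norm (integral {a..b} (\<lambda>s. f s - f a)) \<le> e / 2 * (b - a)"
      proof (rule integral_bound)
        show "continuous_on {a..b} (\<lambda>s. f s - f a)"
          using ab by (intro continuous_intros continuous_on_subset[OF f]) auto
        show "norm (f s - f a) \<le> e / 2" if "s \<in> {a..b}" for s
          using d(2)[of a s] that ab nd by (auto simp: dist_real_def)
      qed (use ab in auto)
      moreover have "integral {a..b} (\<lambda>s. f s - f a) = integral {a..b} f - f a / real n"
        using ab by (subst integral_diff) (auto intro: int)
      ultimately have "\<bar>f a / real n - integral {a..b} f\<bar> \<le> e / 2 / real n"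
        using ab(4) by simp
      moreover have "integral {0..b} f = integral {0..a} f + integral {a..b} f"
        using ab Henstock_Kurzweil_Integration.integral_combine[of 0 a b f] int[of 0 b] by simp
      moreover have "\<bar>(\<Sum>k<m. f (real k / real n)) / real n - integral {0..a} f\<bar> \<le> a * (e / 2)"
        using Suc by (simp add: a_def)
      moreover have "(\<Sum>k<Suc m. f (real k / real n)) / real n =
          (\<Sum>k<m. f (real k / real n)) / real n + f a / real n"
        by (simp add: a_def add_divide_distrib)
      moreover have "b * (e / 2) = a * (e / 2) + e / 2 / real n"
        using ab(4) by (simp add: algebra_simps)
      ultimately show ?case unfolding b_def[symmetric] by linarith
    qed simp
    from this[of n] show ?thesis using n0 e by simp
  qed
  then show "\<exists>no. \<forall>n\<ge>no. norm ((\<Sum>k<n. f (real k / real n)) / real n - integral {0..1} f) < e"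
    by (intro exI[of _ "Suc (nat \<lceil>1 / d\<rceil>)"]) auto
qed

text \<open>The map \<open>h\<close>, which sends \<open>k\<close> to \<open>j - k\<close> modulo
  \<open>n\<close>, is an involution of the indices. Where it wraps around, the argument changes
  from \<open>s\<close> to \<open>1 - s\<close>, which \<open>f\<close> does not see. Hence all row
  sums of the distance kernel on equally spaced points agree.\<close>

lemma sum_circulant:
  fixes f :: "real \<Rightarrow> 'a::comm_monoid_add"
  assumes "j < n" and symm: "\<And>s. f (1 - s) = f s"
  shows "(\<Sum>k<n. f (\<bar>real j - real k\<bar> / real n)) = (\<Sum>k<n. f (real k / real n))"
proof -
  define h where "h k = (if k \<le> j then j - k else n + j - k)" for k
  show ?thesis
  proof (rule sum.reindex_bij_witness[of _ h h])
    fix k assume "k \<in> {..<n}"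
    then have k: "k < n" by simp
    show "h (h k) = k" using k assms(1) by (auto simp: h_def)
    show "h k \<in> {..<n}" using k assms(1) by (auto simp: h_def)
    show "f (real (h k) / real n) = f (\<bar>real j - real k\<bar> / real n)"
    proof (cases "k \<le> j")
      case True
      then show ?thesis by (simp add: h_def of_nat_diff)
    next
      case False
      then have "real (h k) / real n = 1 - \<bar>real j - real k\<bar> / real n"
        using k by (simp add: h_def of_nat_diff field_simps)
      then show ?thesis by (simp add: symm)
    qed
  qed (use assms(1) in \<open>auto simp: h_def\<close>)
qed

section \<open>Magnitude of the circle\<close>

context
  fixes \<kappa> L :: real
  assumes kappa: "\<kappa> \<le> 1" and L: "0 < L"
begin

lemma integral_exp_D_kappa_pos: "0 < integral {0..1} (\<lambda>s. exp (- L * D_kappa \<kappa> s))"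
proof -
  have "0 < 2 / L * (1 - exp (- L / 2))" using L by simp
  then show ?thesis using integral_exp_D_kappa_ge[OF kappa L] by linarith
qed

lemma kappa_circle_kernel_ge:
  assumes "finite W" "W \<subseteq> {0..<L}"
  shows "integral {0..1} (\<lambda>s. exp (- L * D_kappa \<kappa> s)) * (\<Sum>x\<in>W. v x)\<^sup>2 \<le>
    (\<Sum>x\<in>W. \<Sum>y\<in>W. v x * v y * exp (- kappa_dist L \<kappa> x y))"
proof -
  have "integral {0..1} (\<lambda>s. exp (- L * D_kappa \<kappa> s)) * (\<Sum>x\<in>W. v x)\<^sup>2 \<le>
    (\<Sum>x\<in>W. \<Sum>y\<in>W. v x * v y * exp (- L * D_kappa \<kappa> \<bar>x / L - y / L\<bar>))"
  proof (rule convex_kernel_ge[OF assms(1)])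
    show "x / L \<in> {0..<1}" if "x \<in> W" for x
      using that assms(2) L by (auto simp: subset_iff)
    have "convex_on {0..1/2} (\<lambda>s. L * - D_kappa \<kappa> s)"
      using L by (intro convex_on_cmul convex_on_uminus_D_kappa kappa) auto
    from convex_on_exp_compose[OF this]
    show "convex_on {0..1/2} (\<lambda>s. exp (- L * D_kappa \<kappa> s))" by simp
    show "exp (- L * D_kappa \<kappa> y) \<le> exp (- L * D_kappa \<kappa> x)" if "0 \<le> x" "x \<le> y" "y \<le> 1/2" for x y
      using D_kappa_mono[OF kappa that] L by simp
    show "exp (- L * D_kappa \<kappa> (1 - s)) = exp (- L * D_kappa \<kappa> s)" for s
      by (simp add: D_kappa_reflect)
    show "(\<lambda>s. exp (- L * D_kappa \<kappa> s)) integrable_on {0..1}"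
      by (rule integrable_exp_D_kappa[OF kappa])
  qed
  also have "\<dots> = (\<Sum>x\<in>W. \<Sum>y\<in>W. v x * v y * exp (- kappa_dist L \<kappa> x y))"
  proof (intro sum.cong refl)
    fix x y assume "x \<in> W" "y \<in> W"
    then have "x \<in> {0..<L}" "y \<in> {0..<L}" using assms(2) by auto
    moreover have "\<bar>x / L - y / L\<bar> = \<bar>x - y\<bar> / L" using L by (simp flip: diff_divide_distrib)
    ultimately show "v x * v y * exp (- L * D_kappa \<kappa> \<bar>x / L - y / L\<bar>) = v x * v y * exp (- kappa_dist L \<kappa> x y)"
      by (simp add: kappa_dist_def)
  qed
  finally show ?thesis .
qed

lemma finite_magnitude_kappa_circle_le:
  assumes "finite W" "W \<subseteq> mspace (kappa_circle L \<kappa>)"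
  shows "finite_magnitude (submetric (kappa_circle L \<kappa>) W) \<le>
    inverse (integral {0..1} (\<lambda>s. exp (- L * D_kappa \<kappa> s)))"
proof (rule finite_magnitude_le)
  have W: "W \<subseteq> {0..<L}" using assms(2) mspace_kappa_circle[OF L kappa] by simp
  have ms: "mspace (submetric (kappa_circle L \<kappa>) W) = W" using assms(2) by auto
  then show "finite (mspace (submetric (kappa_circle L \<kappa>) W))" using assms(1) by simp
  show "integral {0..1} (\<lambda>s. exp (- L * D_kappa \<kappa> s)) *
      (\<Sum>x\<in>mspace (submetric (kappa_circle L \<kappa>) W). v x)\<^sup>2
    \<le> (\<Sum>x\<in>mspace (submetric (kappa_circle L \<kappa>) W). \<Sum>y\<in>mspace (submetric (kappa_circle L \<kappa>) W).
        v x * v y * exp (- mdist (submetric (kappa_circle L \<kappa>) W) x y))" for v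
    unfolding ms mdist_submetric mdist_kappa_circle[OF L kappa]
    by (rule kappa_circle_kernel_ge[OF assms(1) W])
qed (rule integral_exp_D_kappa_pos)

text \<open>All rows have the same sum \<open>S\<close> by \<open>sum_circulant\<close>, so the
  constant \<open>1 / S\<close> is a weighting and the magnitude is \<open>n / S\<close>.\<close>

lemma finite_magnitude_equally_spaced:
  assumes "0 < n"
  defines "W \<equiv> (\<lambda>k. L * real k / real n) ` {..<n}"
  shows "finite W" "W \<subseteq> mspace (kappa_circle L \<kappa>)"
    "finite_magnitude (submetric (kappa_circle L \<kappa>) W) =
      inverse ((\<Sum>k<n. exp (- L * D_kappa \<kappa> (real k / real n))) / real n)"
proof -
  define F where "F s = exp (- L * D_kappa \<kappa> s)" for s
  define S where "S = (\<Sum>k<n. F (real k / real n))"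
  have S: "0 < S" unfolding S_def using assms(1) by (intro sum_pos) (auto simp: F_def)
  show "finite W" by (simp add: W_def)
  have sub: "W \<subseteq> {0..<L}" using L assms(1) by (auto simp: W_def field_simps)
  then show sub': "W \<subseteq> mspace (kappa_circle L \<kappa>)" by (simp add: mspace_kappa_circle[OF L kappa])
  have ms: "mspace (submetric (kappa_circle L \<kappa>) W) = W" using sub' by auto
  have inj: "inj_on (\<lambda>k. L * real k / real n) {..<n}" using L assms(1) by (auto intro: inj_onI)
  have "weighting (submetric (kappa_circle L \<kappa>) W) (\<lambda>_. 1 / S)"
    unfolding weighting_def ms mdist_submetric mdist_kappa_circle[OF L kappa]
  proof
    fix x assume x: "x \<in> W"
    then obtain j where j: "j < n" "x = L * real j / real n" by (auto simp: W_def)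
    have "(\<Sum>y\<in>W. exp (- kappa_dist L \<kappa> x y)) = (\<Sum>k<n. exp (- kappa_dist L \<kappa> x (L * real k / real n)))"
      unfolding W_def by (subst sum.reindex[OF inj]) simp
    also have "\<dots> = (\<Sum>k<n. F (\<bar>real j - real k\<bar> / real n))"
    proof (intro sum.cong refl)
      fix k assume "k \<in> {..<n}"
      then have "L * real k / real n \<in> {0..<L}" "x \<in> {0..<L}" using sub x by (auto simp: W_def)
      moreover have "\<bar>x - L * real k / real n\<bar> / L = \<bar>real j - real k\<bar> / real n"
      proof -
        have "x - L * real k / real n = L * ((real j - real k) / real n)"
          using j by (simp add: field_simps)
        then show ?thesis using L by (simp add: abs_mult)
      qed
      ultimately show "exp (- kappa_dist L \<kappa> x (L * real k / real n)) = F (\<bar>real j - real k\<bar> / real n)"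
        by (simp add: kappa_dist_def F_def)
    qed
    also have "\<dots> = S"
      unfolding S_def by (rule sum_circulant[OF j(1)]) (simp add: F_def D_kappa_reflect)
    finally show "(\<Sum>y\<in>W. exp (- kappa_dist L \<kappa> x y) * (1 / S)) = 1"
      using S by (simp flip: sum_divide_distrib)
  qed
  from finite_magnitude_eq[OF this]
  have "finite_magnitude (submetric (kappa_circle L \<kappa>) W) = real (card W) / S"
    unfolding ms by simp
  also have "card W = n" unfolding W_def using inj by (simp add: card_image)
  finally show "finite_magnitude (submetric (kappa_circle L \<kappa>) W) =
      inverse ((\<Sum>k<n. exp (- L * D_kappa \<kappa> (real k / real n))) / real n)"
    by (simp add: S_def F_def)
qed

lemma magnitude_kappa_circle:
  "magnitude (kappa_circle L \<kappa>) = ereal (inverse (integral {0..1} (\<lambda>s. exp (- L * D_kappa \<kappa> s))))"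
    (is "?M = ereal (inverse ?I)")
proof (rule antisym)
  show "?M \<le> ereal (inverse ?I)"
    unfolding magnitude_def by (intro SUP_least) (use finite_magnitude_kappa_circle_le in auto)
  have "continuous_on {0..1} (\<lambda>s. exp (- L * D_kappa \<kappa> s))"
    by (intro continuous_intros continuous_on_D_kappa kappa)
  from Riemann_sum_tendsto[OF this]
  have "(\<lambda>n. ereal (inverse ((\<Sum>k<n. exp (- L * D_kappa \<kappa> (real k / real n))) / real n))) \<longlonglongrightarrow> ereal (inverse ?I)"
    using integral_exp_D_kappa_pos by (intro tendsto_ereal tendsto_inverse) auto
  moreover have "ereal (inverse ((\<Sum>k<n. exp (- L * D_kappa \<kappa> (real k / real n))) / real n)) \<le> ?M" if "1 \<le> n" for n
    unfolding magnitude_def using finite_magnitude_equally_spaced[of n] that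
    by (intro SUP_upper2[of "(\<lambda>k. L * real k / real n) ` {..<n}"]) auto
  ultimately show "ereal (inverse ?I) \<le> ?M" by (intro LIMSEQ_le_const2) blast+
qed

end

theorem theorem16:
  fixes \<kappa> :: real
  assumes "\<kappa> \<le> 1"
  shows "(\<forall>L>0. magnitude (kappa_circle L \<kappa>) =
            ereal (inverse (integral {0..1} (\<lambda>s. exp (- L * D_kappa \<kappa> s)))))
       \<and> (\<lambda>L. real_of_ereal (magnitude (kappa_circle L \<kappa>)) - L / 2) \<in> O[at_top](\<lambda>L. inverse L)"
proof
  show "\<forall>L>0. magnitude (kappa_circle L \<kappa>) = ereal (inverse (integral {0..1} (\<lambda>s. exp (- L * D_kappa \<kappa> s))))"
    using magnitude_kappa_circle[OF assms] by blast
  \<comment> \<open>\<open>B\<close> does not depend on \<open>L\<close>, so it can serve as the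
    constant in the asymptotic estimate.\<close>
  obtain B where B: "\<And>L. 0 < L \<Longrightarrow>
      \<bar>inverse (integral {0..1} (\<lambda>s. exp (- L * D_kappa \<kappa> s))) - L / 2\<bar> \<le> B / L"
    using inverse_integral_exp_D_kappa_asymp[OF assms] by blast
  show "(\<lambda>L. real_of_ereal (magnitude (kappa_circle L \<kappa>)) - L / 2) \<in> O[at_top](\<lambda>L. inverse L)"
  proof (rule bigoI[of _ B])
    show "\<forall>\<^sub>F L in at_top. norm (real_of_ereal (magnitude (kappa_circle L \<kappa>)) - L / 2) \<le> B * norm (inverse L)"
      using eventually_gt_at_top[of 0]
    proof eventually_elim
      case (elim L)
      then have "B * norm (inverse L) = B / L" by (simp add: divide_inverse)
      then show ?case
        using B[OF elim] unfolding magnitude_kappa_circle[OF assms elim] by simp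
    qed
  qed
qed

end
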